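(* Let $$\mathfrak{A}:=\Big\{f\in\mathfrak{C}:\ \exists\text{ a bounded sequence }\{x_n\}_{n\in\mathbb{N}}\subset\mathbb{R}^d\text{ and }t_n\to\infty\text{ such that }d_{\mathfrak{C}}(\mathcal{T}_{t_n}id_{x_n},f)\to0\text{ as }n\to\infty\Big\}$$ be the $\mathcal{D}$-attractor of the Volterra semiflow. Then the functions in $\mathfrak{A}$ are equi globally Hölder continuous: $$\|f(\theta_1)-f(\theta_2)\|\le\frac{G_*}{\alpha\Gamma(\alpha)}\,|\theta_1-\theta_2|^\alpha,\quad\forall f\in\mathfrak{A},\ \theta_1,\theta_2\ge0 .$$
   Context: Let $d\in\mathbb{N}$, $\alpha\in(0,1)$, and let $\langle\cdot,\cdot\rangle$, $\|\cdot\|$ be the standard inner product and norm of $\mathbb{R}^d$. Let $g:\mathbb{R}^d\to\mathbb{R}^d$ be locally Lipschitz and satisfy $\langle x,g(x)\rangle\le a-b\|x\|^2$ for all $x\in\mathbb{R}^d$, for some constants $a,b>0$. Put $\delta^*:=\sqrt{a/b+1}$, $B^*:=\{y\in\mathbb{R}^d:\|y\|\le\delta^*\}$ and $G_*:=\sup_{x\in B^*}\sqrt d\,\|g(x)\|$. $\Gamma$ is the Gamma function. Let $\mathfrak{C}:=C([0,\infty),\mathbb{R}^d)$ be the space of continuous functions $f:[0,\infty)\to\mathbb{R}^d$, with the metric $$d_{\mathfrak{C}}(f,h):=\|f(0)-h(0)\|+\sum_{k=1}^\infty\frac1{2^k}\frac{\sup_{\theta\in[0,k]}\|f(\theta)-h(\theta)\|}{1+\sup_{\theta\in[0,k]}\|f(\theta)-h(\theta)\|}.$$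 For $f\in\mathfrak{C}$ let $x_f\in\mathfrak{C}$ denote the solution of the Volterra integral equation $x_f(t)=f(t)+\frac1{\Gamma(\alpha)}\int_0^t(t-s)^{\alpha-1}g(x_f(s))\,ds$, $t\ge0$, and define for $t\ge0$ $$(\mathcal{T}_tf)(\theta):=f(t+\theta)+\frac1{\Gamma(\alpha)}\int_0^t(t+\theta-s)^{\alpha-1}g(x_f(s))\,ds,\quad\theta\ge0.$$ It is taken as known that $\{\mathcal{T}_t\}_{t\ge0}$ is a semiflow of continuous operators on $\mathfrak{C}$ (with the compact-open topology); it is called the Volterra semiflow. For $x_0\in\mathbb{R}^d$ let $id_{x_0}\in\mathfrak{C}$ be the constant function $id_{x_0}(\theta)\equiv x_0$. $\mathcal{D}$ is the collection of all sets $\{id_{x_0}:x_0\in D_0\}$ with $D_0\subset\mathbb{R}^d$ bounded; the name "$\mathcal{D}$-attractor" for $\mathfrak{A}$ refers to attraction of these sets, and only the displayed definition of $\mathfrak{A}$ is needed. *)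

theory Defs
  imports "HOL-Analysis.Analysis"
begin

text \<open>
  A function on \<open>[0,\<infinity>)\<close> is represented by a total function on \<open>real\<close>; its values at
  negative arguments are arbitrary and never enter any notion below.
\<close>

definition C_space :: "(real \<Rightarrow> real ^ 'n) set" where
  "C_space = {f. continuous_on {0..} f}"

definition sup_dist :: "nat \<Rightarrow> (real \<Rightarrow> real ^ 'n) \<Rightarrow> (real \<Rightarrow> real ^ 'n) \<Rightarrow> real" where
  "sup_dist k f h = (SUP \<theta>\<in>{0..real k}. norm (f \<theta> - h \<theta>))"

text \<open>The series over \<open>k \<ge> 1\<close> is shifted so as to start at \<open>0\<close>.\<close>

definition C_dist :: "(real \<Rightarrow> real ^ 'n) \<Rightarrow> (real \<Rightarrow> real ^ 'n) \<Rightarrow> real" where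
  "C_dist f h = norm (f 0 - h 0) +
     (\<Sum>k. 1 / 2 ^ Suc k * (sup_dist (Suc k) f h / (1 + sup_dist (Suc k) f h)))"

definition is_volterra_solution ::
    "real \<Rightarrow> (real ^ 'n \<Rightarrow> real ^ 'n) \<Rightarrow> (real \<Rightarrow> real ^ 'n) \<Rightarrow> (real \<Rightarrow> real ^ 'n) \<Rightarrow> bool" where
  "is_volterra_solution \<alpha> g f x \<longleftrightarrow> x \<in> C_space \<and>
     (\<forall>t\<ge>0. x t = f t +
        (1 / Gamma \<alpha>) *\<^sub>R integral {0..t} (\<lambda>s. (t - s) powr (\<alpha> - 1) *\<^sub>R g (x s)))"

text \<open>
  For locally Lipschitz dissipative \<open>g\<close> and \<open>f \<in> C_space\<close> a solution exists and is unique on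
  \<open>[0,\<infinity>)\<close>. \<open>SOME\<close> is used rather than \<open>THE\<close> only because solutions, as total functions,
  may differ at negative arguments.
\<close>

definition volterra_solution ::
    "real \<Rightarrow> (real ^ 'n \<Rightarrow> real ^ 'n) \<Rightarrow> (real \<Rightarrow> real ^ 'n) \<Rightarrow> real \<Rightarrow> real ^ 'n" where
  "volterra_solution \<alpha> g f = (SOME x. is_volterra_solution \<alpha> g f x)"

definition volterra_semiflow ::
    "real \<Rightarrow> (real ^ 'n \<Rightarrow> real ^ 'n) \<Rightarrow> real \<Rightarrow> (real \<Rightarrow> real ^ 'n) \<Rightarrow> real \<Rightarrow> real ^ 'n" where
  "volterra_semiflow \<alpha> g t f = (\<lambda>\<theta>. f (t + \<theta>) +
     (1 / Gamma \<alpha>) *\<^sub>R integral {0..t}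
        (\<lambda>s. (t + \<theta> - s) powr (\<alpha> - 1) *\<^sub>R g (volterra_solution \<alpha> g f s)))"

definition id_fun :: "real ^ 'n \<Rightarrow> real \<Rightarrow> real ^ 'n" where
  "id_fun x0 = (\<lambda>_. x0)"

definition volterra_attractor ::
    "real \<Rightarrow> (real ^ 'n \<Rightarrow> real ^ 'n) \<Rightarrow> (real \<Rightarrow> real ^ 'n) set" where
  "volterra_attractor \<alpha> g = {f \<in> C_space.
     \<exists>(x :: nat \<Rightarrow> real ^ 'n) (t :: nat \<Rightarrow> real).
       bounded (range x) \<and> (\<forall>n. t n \<ge> 0) \<and> filterlim t at_top sequentially \<and>
       (\<lambda>n. C_dist (volterra_semiflow \<alpha> g (t n) (id_fun (x n))) f) \<longlonglongrightarrow> 0}"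

definition delta_star :: "real \<Rightarrow> real \<Rightarrow> real" where
  "delta_star a b = sqrt (a / b + 1)"

definition G_star :: "real \<Rightarrow> real \<Rightarrow> (real ^ 'n \<Rightarrow> real ^ 'n) \<Rightarrow> real" where
  "G_star a b g = (SUP y\<in>cball 0 (delta_star a b). sqrt (real CARD('n)) * norm (g y))"

end

theory Submission
  imports Defs
begin

text \<open>
  An element of the attractor is a limit of functions
  \<open>\<theta> \<mapsto> x\<^sub>n + 1 / Gamma \<alpha> * (integral over {0..t\<^sub>n} of (t\<^sub>n + \<theta> - s) powr (\<alpha> - 1) * g (X\<^sub>n s))\<close>,
  where \<open>X\<^sub>n\<close> solves the equation with the constant datum \<open>x\<^sub>n\<close> and \<open>t\<^sub>n \<rightarrow> \<infinity>\<close>. Two facts about the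
  solutions imply the theorem: they are bounded uniformly in \<open>n\<close>, and from a time \<open>T\<close> on, the same
  for all \<open>n\<close>, they stay in the ball \<open>B\<^sup>*\<close> of radius \<open>delta_star a b\<close>. For \<open>\<theta>1 \<le> \<theta>2\<close> the difference
  of the two kernels has mass at most \<open>(\<theta>2 - \<theta>1) powr \<alpha> / \<alpha>\<close> on \<open>{T..t\<^sub>n}\<close>, where \<open>g (X\<^sub>n s)\<close> is
  bounded by \<open>G_star a b g\<close>, while its mass on \<open>{0..T}\<close> tends to \<open>0\<close>; the limit \<open>n \<rightarrow> \<infinity>\<close> gives the
  estimate (\<open>volterra_semiflow_difference_le\<close>).

  Uniform absorption comes from a comparison argument. Let \<open>u s = (norm (X s))\<^sup>2\<close>, let \<open>W\<close> be the
  barrier that descends linearly, with a small slope, from \<open>R\<^sup>2 + 1 + (a / b + 1)\<close> to \<open>a / b + 1\<close>, and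
  suppose that \<open>u\<close> touches \<open>W\<close> for the first time at \<open>t\<close>. Up to an excess controlled by the slope,
  \<open>u\<close> has a maximum at \<open>t\<close>, so a fractional maximum principle forces \<open>X t \<bullet> g (X t)\<close> to be almost
  nonnegative (\<open>fractional_near_maximum_principle\<close>, \<open>dissipative_barrier\<close>). But \<open>u t \<ge> a / b + 1\<close>
  and dissipativity give \<open>X t \<bullet> g (X t) \<le> - b\<close>. The maximum principle is
  proved for continuous right-hand sides by truncating the Marchaud form of the fractional
  derivative, which has positive weights, and letting the truncation tend to zero.

  The semiflow refers to solutions by choice, so a global solution must be shown to exist for every
  constant datum. It is obtained for \<open>g\<close> composed with the projection to a ball by Banach's fixed
  point theorem in a weighted norm, and the barrier argument shows that it never reaches the
  boundary of that ball (\<open>dissipative_volterra_solution_exists\<close>).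
\<close>

section \<open>Integrals against the weakly singular kernel\<close>

lemma powr_diff_le_powr:
  fixes x y \<alpha> :: real
  assumes "0 < \<alpha>" "\<alpha> < 1" "0 \<le> x" "x \<le> y"
  shows "y powr \<alpha> - x powr \<alpha> \<le> (y - x) powr \<alpha>"
proof (cases "x = 0 \<or> y = x")
  case True
  then show ?thesis using assms by auto
next
  case False
  then have pos: "0 < x" "0 < y - x" "0 < y" using assms by auto
  have *: "u \<le> u powr \<alpha>" if "0 < u" "u \<le> 1" for u :: real
    using powr_mono'[of \<alpha> 1 u] that assms by simp
  \<comment> \<open>\<open>u \<le> u powr \<alpha>\<close> on \<open>{0..1}\<close>, applied to the fractions \<open>x / y\<close> and \<open>(y - x) / y\<close> of sum \<open>1\<close>\<close>
  have "1 = x / y + (y - x) / y" using pos by (simp add: field_simps)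
  also have "\<dots> \<le> (x / y) powr \<alpha> + ((y - x) / y) powr \<alpha>"
    using pos by (intro add_mono *) auto
  also have "\<dots> = (x powr \<alpha> + (y - x) powr \<alpha>) / y powr \<alpha>"
    using pos by (simp add: powr_divide add_divide_distrib)
  finally show ?thesis using pos by (simp add: field_simps)
qed

lemma powr_diff_le_tangent:
  fixes x y \<alpha> :: real
  assumes "0 < \<alpha>" "\<alpha> < 1" "0 < x" "x \<le> y"
  shows "y powr \<alpha> - x powr \<alpha> \<le> \<alpha> * (y - x) * x powr (\<alpha> - 1)"
proof (cases "x = y")
  case False
  then have "\<exists>z>x. z < y \<and> y powr \<alpha> - x powr \<alpha> = (y - x) * (\<alpha> * z powr (\<alpha> - 1))"
    using assms by (intro MVT2) (auto intro!: derivative_eq_intros simp: powr_diff)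
  then obtain z where z: "z > x" "y powr \<alpha> - x powr \<alpha> = (y - x) * (\<alpha> * z powr (\<alpha> - 1))"
    by auto
  have "z powr (\<alpha> - 1) \<le> x powr (\<alpha> - 1)"
    using z assms by (intro powr_mono2') auto
  then show ?thesis
    using z assms by (simp add: mult_left_mono mult.commute mult.left_commute)
qed auto

lemma kernel_has_integral:
  fixes \<alpha> c d p :: real
  assumes "0 < \<alpha>" "c \<le> d" "d \<le> p"
  shows "((\<lambda>s. (p - s) powr (\<alpha> - 1)) has_integral ((p - c) powr \<alpha> - (p - d) powr \<alpha>) / \<alpha>) {c..d}"
proof -
  have "((\<lambda>s. (p - s) powr (\<alpha> - 1)) has_integral
      (- ((p - d) powr \<alpha>) / \<alpha>) - (- ((p - c) powr \<alpha>) / \<alpha>)) {c..d}"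
    using assms
    by (intro fundamental_theorem_of_calculus_interior)
       (auto intro!: continuous_intros continuous_on_powr' derivative_eq_intros
             simp: has_real_derivative_iff_has_vector_derivative[symmetric] powr_diff)
  then show ?thesis by (simp add: diff_divide_distrib)
qed

lemma kernel_absolutely_integrable:
  fixes h :: "real \<Rightarrow> 'a::euclidean_space"
  assumes "0 < \<alpha>" "c \<le> d" "d \<le> p" "continuous_on {c..d} h"
  shows "(\<lambda>s. (p - s) powr (\<alpha> - 1) *\<^sub>R h s) absolutely_integrable_on {c..d}"
proof -
  have k: "(\<lambda>s. (p - s) powr (\<alpha> - 1)) absolutely_integrable_on {c..d}"
    using kernel_has_integral[OF assms(1-3)]
    by (intro nonnegative_absolutely_integrable_1) (auto simp: has_integral_iff)
  have "(\<lambda>s. h s) \<in> borel_measurable (lebesgue_on {c..d})" "bounded (h ` {c..d})"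
    using assms
    by (auto intro!: continuous_imp_measurable_on_sets_lebesgue compact_imp_bounded compact_continuous_image)
  from absolutely_integrable_bounded_measurable_product[OF
      bilinear_conv_bounded_bilinear[THEN iffD2, OF bounded_bilinear.flip[OF bounded_bilinear_scaleR]] this(1) _ this(2) k]
  show ?thesis by simp
qed

lemma kernel_integral_norm_le:
  fixes h :: "real \<Rightarrow> 'a::euclidean_space"
  assumes "0 < \<alpha>" "c \<le> d" "d \<le> p" "continuous_on {c..d} h"
    and M: "\<And>s. s \<in> {c..d} \<Longrightarrow> norm (h s) \<le> M"
  shows "norm (integral {c..d} (\<lambda>s. (p - s) powr (\<alpha> - 1) *\<^sub>R h s))
           \<le> M * ((p - c) powr \<alpha> - (p - d) powr \<alpha>) / \<alpha>"
proof -
  note k = kernel_has_integral[OF assms(1-3)]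
  have "norm (integral {c..d} (\<lambda>s. (p - s) powr (\<alpha> - 1) *\<^sub>R h s))
     \<le> integral {c..d} (\<lambda>s. (p - s) powr (\<alpha> - 1) * M)"
    using set_lebesgue_integral_eq_integral(1)[OF kernel_absolutely_integrable[OF assms(1-4)]] M
      has_integral_integrable[OF has_integral_mult_left[OF k, of M]]
    by (intro integral_norm_bound_integral) (auto intro!: mult_left_mono)
  also have "\<dots> = M * ((p - c) powr \<alpha> - (p - d) powr \<alpha>) / \<alpha>"
    using has_integral_mult_left[OF k, of M] by (simp add: has_integral_iff field_simps)
  finally show ?thesis .
qed

text \<open>
  The kernel decreases in its pole position, so the difference of two kernels has a constant sign
  and its mass is computed exactly. The bound depends only on the end \<open>d\<close> of the interval, and this
  serves two purposes: if \<open>d\<close> stays fixed while \<open>p, q\<close> move away it tends to \<open>0\<close> (memory of the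
  distant past fades), and in any case it is at most \<open>M / \<alpha> * (q - p) powr \<alpha>\<close> (a Hoelder
  bound).
\<close>

lemma kernel_difference_integral_norm_le:
  fixes h :: "real \<Rightarrow> 'a::euclidean_space"
  assumes "0 < \<alpha>" "\<alpha> < 1" "c \<le> d" "d \<le> p" "p \<le> q" "continuous_on {c..d} h"
    and M: "\<And>s. s \<in> {c..d} \<Longrightarrow> norm (h s) \<le> M"
  shows "norm (integral {c..d} (\<lambda>s. (p - s) powr (\<alpha> - 1) *\<^sub>R h s)
             - integral {c..d} (\<lambda>s. (q - s) powr (\<alpha> - 1) *\<^sub>R h s))
           \<le> M / \<alpha> * ((q - d) powr \<alpha> - (p - d) powr \<alpha>)"
proof -
  have "d \<le> q" using assms by simp
  note kp = kernel_has_integral[OF assms(1,3,4)]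
   and kq = kernel_has_integral[OF assms(1,3) \<open>d \<le> q\<close>]
   and ip = set_lebesgue_integral_eq_integral(1)[OF kernel_absolutely_integrable[OF assms(1,3,4,6)]]
   and iq = set_lebesgue_integral_eq_integral(1)[OF kernel_absolutely_integrable[OF assms(1,3) \<open>d \<le> q\<close> assms(6)]]
  have M0: "0 \<le> M" using M[of c] assms norm_ge_zero order_trans by (metis atLeastAtMost_iff order_refl)
  note kd = has_integral_mult_left[OF has_integral_diff[OF kp kq], of M]
  have mono: "(q - s) powr (\<alpha> - 1) \<le> (p - s) powr (\<alpha> - 1)" if "s < p" for s
    using that assms by (intro powr_mono2') auto
  \<comment> \<open>At \<open>s = p = d\<close> the first kernel has the default value \<open>0\<close>, which spoils monotonicity in one point.\<close>
  let ?D = "\<lambda>s. (p - s) powr (\<alpha> - 1) *\<^sub>R h s - (q - s) powr (\<alpha> - 1) *\<^sub>R h s"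
  let ?K = "\<lambda>s. ((p - s) powr (\<alpha> - 1) - (q - s) powr (\<alpha> - 1)) * M"
  have "integral {c..d} ?D = integral {c..d} (\<lambda>s. if s = p then 0 else ?D s)"
    by (rule integral_spike[of "{p}"]) auto
  moreover have "norm (integral {c..d} (\<lambda>s. if s = p then 0 else ?D s))
      \<le> integral {c..d} (\<lambda>s. if s = p then 0 else ?K s)"
  proof (rule integral_norm_bound_integral)
    show "(\<lambda>s. if s = p then 0 else ?D s) integrable_on {c..d}"
      using integrable_diff[OF ip iq] by (rule integrable_spike[of _ _ "{p}"]) auto
    show "(\<lambda>s. if s = p then 0 else ?K s) integrable_on {c..d}"
      using has_integral_integrable[OF kd] by (rule integrable_spike[of _ _ "{p}"]) auto
    show "norm (if s = p then 0 else ?D s) \<le> (if s = p then 0 else ?K s)" if "s \<in> {c..d}" for s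
      using that assms mono[of s] M[OF that]
      by (auto simp: scaleR_diff_left[symmetric] intro!: mult_left_mono)
  qed
  moreover have "integral {c..d} (\<lambda>s. if s = p then 0 else ?K s) = integral {c..d} ?K"
    by (rule integral_spike[of "{p}"]) auto
  moreover have "integral {c..d} ?K
      = M / \<alpha> * (((p - c) powr \<alpha> - (q - c) powr \<alpha>) + ((q - d) powr \<alpha> - (p - d) powr \<alpha>))"
    by (subst integral_unique[OF kd])
       (simp add: algebra_simps add_divide_distrib diff_divide_distrib)
  moreover have "\<dots> \<le> M / \<alpha> * ((q - d) powr \<alpha> - (p - d) powr \<alpha>)"
    using assms M0 powr_mono2[of \<alpha> "p - c" "q - c"] by (intro mult_left_mono) auto
  ultimately show ?thesis
    by (simp add: integral_diff[OF ip iq])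
qed

section \<open>Swapping the integrals in a truncated fractional derivative\<close>

text \<open>
  Fubini's theorem is used for the Lebesgue integral on the whole line, while all other
  computations are about gauge integrals on intervals; this lemma translates between the two.
\<close>

lemma lborel_integral_eq_henstock:
  fixes f g :: "real \<Rightarrow> real"
  assumes "f \<in> borel_measurable borel" "g absolutely_integrable_on S"
    and "\<And>x. f x = (if x \<in> S then g x else 0)"
  shows "integrable lborel f" "integral\<^sup>L lborel f = integral S g"
proof -
  have fg: "f = (\<lambda>x. if x \<in> S then g x else 0)" using assms(3) by auto
  have "integrable lebesgue f"
    using assms(2) unfolding fg set_integrable_def
    by (rule back_subst[of "integrable lebesgue"]) (auto simp: indicator_def)
  then show int: "integrable lborel f"
    using assms(1) by (simp add: integrable_completion)
  show "integral\<^sup>L lborel f = integral S g"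
    using has_integral_integral_lborel[OF int] by (simp add: fg integral_restrict_UNIV integral_unique[symmetric])
qed

text \<open>
  The substitution \<open>s \<mapsto> (s - r) / (t - s)\<close> yields an elementary antiderivative, because the two
  exponents add up to \<open>-2\<close>.
\<close>

lemma beta_type_kernel_has_integral:
  fixes \<alpha> r T t :: real
  assumes "0 < \<alpha>" "r \<le> T" "T < t"
  shows "((\<lambda>s. (t - s) powr (- \<alpha> - 1) * (s - r) powr (\<alpha> - 1))
           has_integral ((T - r) / (t - T)) powr \<alpha> / (\<alpha> * (t - r))) {r..T}"
proof -
  let ?\<Psi> = "\<lambda>s. ((s - r) / (t - s)) powr \<alpha> / (\<alpha> * (t - r))"
  have "((\<lambda>s. (t - s) powr (- \<alpha> - 1) * (s - r) powr (\<alpha> - 1)) has_integral (?\<Psi> T - ?\<Psi> r)) {r..T}"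
  proof (rule fundamental_theorem_of_calculus_interior)
    show "continuous_on {r..T} ?\<Psi>"
      using assms by (intro continuous_intros continuous_on_powr') auto
    fix s assume s: "s \<in> {r<..<T}"
    then have "0 < s - r" "0 < t - s" "0 < t - r" using assms by auto
    have D: "((\<lambda>s. (s - r) / (t - s)) has_real_derivative (t - r) / (t - s)\<^sup>2) (at s)"
      using \<open>0 < t - s\<close> by (auto intro!: derivative_eq_intros simp: power2_eq_square field_simps)
    have "(?\<Psi> has_real_derivative
        (\<alpha> * ((s - r) / (t - s)) powr (\<alpha> - 1) * ((t - r) / (t - s)\<^sup>2)) / (\<alpha> * (t - r))) (at s)"
      using \<open>0 < s - r\<close> \<open>0 < t - s\<close>
      by (intro DERIV_cdivide DERIV_chain2[OF _ D] has_real_derivative_powr) auto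
    also have "(\<alpha> * ((s - r) / (t - s)) powr (\<alpha> - 1) * ((t - r) / (t - s)\<^sup>2)) / (\<alpha> * (t - r))
        = ((s - r) / (t - s)) powr (\<alpha> - 1) / (t - s)\<^sup>2"
      using \<open>0 < t - r\<close> assms(1) by simp
    also have "\<dots> = (t - s) powr (- \<alpha> - 1) * (s - r) powr (\<alpha> - 1)"
    proof -
      have "(t - s) powr (\<alpha> - 1) * (t - s)\<^sup>2 = (t - s) powr (\<alpha> - 1) * (t - s) powr 2"
        using \<open>0 < t - s\<close> by (simp add: powr_numeral)
      also have "\<dots> = (t - s) powr (\<alpha> + 1)"
        by (subst powr_add[symmetric]) (simp add: add.commute)
      finally show ?thesis
        using \<open>0 < s - r\<close> \<open>0 < t - s\<close> powr_minus_divide[of "t - s" "\<alpha> + 1"]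
        by (simp add: powr_divide)
    qed
    finally show "(?\<Psi> has_vector_derivative (t - s) powr (- \<alpha> - 1) * (s - r) powr (\<alpha> - 1)) (at s)"
      by (simp add: has_real_derivative_iff_has_vector_derivative)
  qed (use assms in auto)
  then show ?thesis by simp
qed

text \<open>
  With \<open>T = t - \<epsilon>\<close>, the left-hand side is the memory term of the Marchaud derivative truncated at
  distance \<open>\<epsilon>\<close> from \<open>t\<close>, applied to a fractional integral of \<open>q\<close>. By Fubini's theorem on the
  triangle \<open>r \<le> s\<close> it becomes a single integral of \<open>q\<close> against an explicit kernel.
\<close>

lemma truncated_marchaud_integral_swap:
  fixes q :: "real \<Rightarrow> real"
  assumes "0 < \<alpha>" "0 \<le> T" "T < t" and q: "continuous_on {0..T} q"
  shows "integral {0..T} (\<lambda>s. (t - s) powr (- \<alpha> - 1) * integral {0..s} (\<lambda>r. (s - r) powr (\<alpha> - 1) * q r))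
       = integral {0..T} (\<lambda>r. ((T - r) / (t - T)) powr \<alpha> / (\<alpha> * (t - r)) * q r)"
proof -
  define q' where "q' r = (if r \<in> {0..T} then q r else 0)" for r
  have [measurable]: "q' \<in> borel_measurable borel"
  proof -
    have "q' = (\<lambda>r. indicator {0..T} r *\<^sub>R q r)"
      by (auto simp: q'_def fun_eq_iff indicator_def)
    then show ?thesis using borel_measurable_continuous_on_indicator[OF _ q] by simp
  qed
  define F where "F r s = (if 0 \<le> r \<and> r \<le> s \<and> s \<le> T
      then (t - s) powr (- \<alpha> - 1) * (s - r) powr (\<alpha> - 1) * q' r else 0)" for r s
  have F_meas: "case_prod F \<in> borel_measurable (lborel \<Otimes>\<^sub>M lborel)"
    unfolding F_def by measurable
  have [measurable]: "F r \<in> borel_measurable borel" "(\<lambda>r. F r s) \<in> borel_measurable borel" for r s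
    unfolding F_def by measurable
  have kabs: "(\<lambda>s. (t - s) powr (- \<alpha> - 1) * (s - r) powr (\<alpha> - 1)) absolutely_integrable_on {r..T}"
    if "r \<le> T" for r
    using beta_type_kernel_has_integral[OF assms(1) that assms(3)]
    by (intro nonnegative_absolutely_integrable_1) (auto simp: has_integral_iff)
  have in_s: "integrable lborel (F r)"
    "integral\<^sup>L lborel (F r) = (if r \<in> {0..T} then ((T - r) / (t - T)) powr \<alpha> / (\<alpha> * (t - r)) * q r else 0)"
    "integral\<^sup>L lborel (\<lambda>s. \<bar>F r s\<bar>) = (if r \<in> {0..T} then ((T - r) / (t - T)) powr \<alpha> / (\<alpha> * (t - r)) * \<bar>q r\<bar> else 0)" for r
  proof -
    have "integrable lborel (F r) \<and> integral\<^sup>L lborel (F r) = (if r \<in> {0..T} then ((T - r) / (t - T)) powr \<alpha> / (\<alpha> * (t - r)) * q r else 0)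
      \<and> integral\<^sup>L lborel (\<lambda>s. \<bar>F r s\<bar>) = (if r \<in> {0..T} then ((T - r) / (t - T)) powr \<alpha> / (\<alpha> * (t - r)) * \<bar>q r\<bar> else 0)"
    proof (cases "r \<in> {0..T}")
      case True
      then have *: "r \<le> T" by simp
      have k: "(\<lambda>s. (t - s) powr (- \<alpha> - 1) * (s - r) powr (\<alpha> - 1) * c) absolutely_integrable_on {r..T}"
        "integral {r..T} (\<lambda>s. (t - s) powr (- \<alpha> - 1) * (s - r) powr (\<alpha> - 1) * c)
          = ((T - r) / (t - T)) powr \<alpha> / (\<alpha> * (t - r)) * c" for c
        using kabs[OF *] integral_unique[OF beta_type_kernel_has_integral[OF assms(1) * assms(3)]]
        by (auto intro!: set_integrable_mult_left)
      have eq: "F r s = (if s \<in> {r..T} then (t - s) powr (- \<alpha> - 1) * (s - r) powr (\<alpha> - 1) * q r else 0)"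
        "\<bar>F r s\<bar> = (if s \<in> {r..T} then (t - s) powr (- \<alpha> - 1) * (s - r) powr (\<alpha> - 1) * \<bar>q r\<bar> else 0)" for s
        using True by (auto simp: F_def q'_def abs_mult)
      have "F r \<in> borel_measurable borel" "(\<lambda>s. \<bar>F r s\<bar>) \<in> borel_measurable borel"
        by measurable
      note lborel_integral_eq_henstock[OF this(1) k(1) eq(1)]
        lborel_integral_eq_henstock[OF this(2) k(1) eq(2)]
      then show ?thesis using True unfolding k(2) by simp
    next
      case False
      then have "F r = (\<lambda>s. 0)" by (auto simp: F_def fun_eq_iff)
      then show ?thesis using False by auto
    qed
    then show "integrable lborel (F r)"
    "integral\<^sup>L lborel (F r) = (if r \<in> {0..T} then ((T - r) / (t - T)) powr \<alpha> / (\<alpha> * (t - r)) * q r else 0)"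
    "integral\<^sup>L lborel (\<lambda>s. \<bar>F r s\<bar>) = (if r \<in> {0..T} then ((T - r) / (t - T)) powr \<alpha> / (\<alpha> * (t - r)) * \<bar>q r\<bar> else 0)"
      by blast+
  qed
  have outer: "(\<lambda>r. ((T - r) / (t - T)) powr \<alpha> / (\<alpha> * (t - r)) * p r) absolutely_integrable_on {0..T}"
    if "continuous_on {0..T} p" for p :: "real \<Rightarrow> real"
    using that assms
    by (intro absolutely_integrable_continuous_real continuous_intros continuous_on_powr') auto
  \<comment> \<open>Integrating over \<open>s\<close> first gives a kernel that is continuous in \<open>r\<close>, so absolute integrability is checked in this order.\<close>
  have "integrable lborel (\<lambda>r. integral\<^sup>L lborel (\<lambda>s. \<bar>F r s\<bar>))"
    unfolding in_s(3)
  proof (rule lborel_integral_eq_henstock)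
    show "(\<lambda>r. ((T - r) / (t - T)) powr \<alpha> / (\<alpha> * (t - r)) * \<bar>q r\<bar>) absolutely_integrable_on {0..T}"
      using q by (intro outer continuous_intros)
    have "(\<lambda>r. if r \<in> {0..T} then ((T - r) / (t - T)) powr \<alpha> / (\<alpha> * (t - r)) * \<bar>q' r\<bar> else 0) \<in> borel_measurable borel"
      by measurable
    then show "(\<lambda>r. if r \<in> {0..T} then ((T - r) / (t - T)) powr \<alpha> / (\<alpha> * (t - r)) * \<bar>q r\<bar> else 0) \<in> borel_measurable borel"
      by (simp add: q'_def cong: if_cong)
  qed simp
  then have Fint: "integrable (lborel \<Otimes>\<^sub>M lborel) (case_prod F)"
    using F_meas in_s(1) by (intro lborel_pair.Fubini_integrable) (auto intro!: AE_I2)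
  have in_r: "integral\<^sup>L lborel (\<lambda>r. F r s) = (if s \<in> {0..T} then
       (t - s) powr (- \<alpha> - 1) * integral {0..s} (\<lambda>r. (s - r) powr (\<alpha> - 1) * q r) else 0)" for s
  proof (cases "s \<in> {0..T}")
    case True
    have k: "(\<lambda>r. (t - s) powr (- \<alpha> - 1) * ((s - r) powr (\<alpha> - 1) * q r)) absolutely_integrable_on {0..s}"
      using True kernel_absolutely_integrable[OF assms(1), of 0 s s q] continuous_on_subset[OF q, of "{0..s}"]
      by (intro set_integrable_mult_right) auto
    have "integral\<^sup>L lborel (\<lambda>r. F r s)
        = integral {0..s} (\<lambda>r. (t - s) powr (- \<alpha> - 1) * ((s - r) powr (\<alpha> - 1) * q r))"
      using True by (intro lborel_integral_eq_henstock[OF _ k]) (auto simp: F_def q'_def)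
    then show ?thesis using True by simp
  next
    case False
    then have "(\<lambda>r. F r s) = (\<lambda>r. 0)" by (auto simp: F_def fun_eq_iff)
    then show ?thesis using False by auto
  qed
  let ?L = "\<lambda>s. (t - s) powr (- \<alpha> - 1) * integral {0..s} (\<lambda>r. (s - r) powr (\<alpha> - 1) * q r)"
  have L: "integrable lborel (\<lambda>s. integral\<^sup>L lborel (\<lambda>r. F r s))"
    using Fint by (rule lborel_pair.integrable_snd)
  have "integral {0..T} ?L = integral UNIV (\<lambda>s. integral\<^sup>L lborel (\<lambda>r. F r s))"
    unfolding in_r by (subst integral_restrict_UNIV[symmetric]) simp
  also have "\<dots> = (\<integral>s. (\<integral>r. F r s \<partial>lborel) \<partial>lborel)"
    using has_integral_integral_lborel[OF L] by (rule integral_unique)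
  also have "\<dots> = (\<integral>r. (\<integral>s. F r s \<partial>lborel) \<partial>lborel)"
    using lborel_pair.Fubini_integral[OF Fint] .
  also have "\<dots> = integral UNIV (\<lambda>r. integral\<^sup>L lborel (F r))"
    using has_integral_integral_lborel[OF lborel_pair.integrable_fst[OF Fint]] by (simp add: integral_unique)
  also have "\<dots> = integral {0..T} (\<lambda>r. ((T - r) / (t - T)) powr \<alpha> / (\<alpha> * (t - r)) * q r)"
    unfolding in_s(2) by (simp only: integral_restrict_UNIV)
  finally show ?thesis .
qed

section \<open>Fractional integrals and a maximum principle\<close>

text \<open>
  This is \<open>Gamma \<alpha>\<close> times the Riemann-Liouville integral of order \<open>\<alpha>\<close>. The normalisation is left
  to the users of the definition because the Volterra equation carries the factor \<open>1 / Gamma \<alpha>\<close>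
  outside of the integral.
\<close>

definition frac_int :: "real \<Rightarrow> (real \<Rightarrow> 'a::euclidean_space) \<Rightarrow> real \<Rightarrow> 'a" where
  "frac_int \<alpha> h t = integral {0..t} (\<lambda>s. (t - s) powr (\<alpha> - 1) *\<^sub>R h s)"

lemma frac_int_holder:
  fixes h :: "real \<Rightarrow> 'a::euclidean_space"
  assumes "0 < \<alpha>" "\<alpha> < 1" "0 \<le> t1" "t1 \<le> t2" and h: "continuous_on {0..t2} h"
    and M: "\<And>s. s \<in> {0..t2} \<Longrightarrow> norm (h s) \<le> M"
  shows "norm (frac_int \<alpha> h t2 - frac_int \<alpha> h t1) \<le> 2 * M / \<alpha> * (t2 - t1) powr \<alpha>"
proof -
  let ?k = "\<lambda>p s. (p - s) powr (\<alpha> - 1) *\<^sub>R h s"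
  have h1: "continuous_on {0..t1} h" and h2: "continuous_on {t1..t2} h"
    using assms by (auto intro: continuous_on_subset[OF h])
  have "?k t2 integrable_on {0..t2}"
    using assms by (intro set_lebesgue_integral_eq_integral(1) kernel_absolutely_integrable) auto
  then have "frac_int \<alpha> h t2 = integral {0..t1} (?k t2) + integral {t1..t2} (?k t2)"
    unfolding frac_int_def using assms by (simp add: Henstock_Kurzweil_Integration.integral_combine)
  then have "frac_int \<alpha> h t2 - frac_int \<alpha> h t1
      = integral {t1..t2} (?k t2) - (integral {0..t1} (?k t1) - integral {0..t1} (?k t2))"
    unfolding frac_int_def by simp
  then have "norm (frac_int \<alpha> h t2 - frac_int \<alpha> h t1)
      \<le> norm (integral {0..t1} (?k t1) - integral {0..t1} (?k t2)) + norm (integral {t1..t2} (?k t2))"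
    by (simp only: add.commute norm_triangle_ineq4)
  also have "\<dots> \<le> M / \<alpha> * ((t2 - t1) powr \<alpha> - (t1 - t1) powr \<alpha>)
      + M * ((t2 - t1) powr \<alpha> - (t2 - t2) powr \<alpha>) / \<alpha>"
    using assms h1 h2
    by (intro add_mono kernel_difference_integral_norm_le kernel_integral_norm_le) auto
  finally show ?thesis by simp
qed

lemma holder_imp_continuous_on:
  fixes f :: "real \<Rightarrow> 'a::real_normed_vector"
  assumes "0 < \<alpha>"
    and "\<And>x y. x \<in> S \<Longrightarrow> y \<in> S \<Longrightarrow> x \<le> y \<Longrightarrow> norm (f y - f x) \<le> C * (y - x) powr \<alpha>"
  shows "continuous_on S f"
  unfolding continuous_on_def
proof
  fix x assume "x \<in> S"
  have "((\<lambda>y. C * \<bar>y - x\<bar> powr \<alpha>) \<longlongrightarrow> C * \<bar>x - x\<bar> powr \<alpha>) (at x within S)"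
    using assms(1) by (intro tendsto_intros tendsto_powr') auto
  moreover have "norm (f y - f x) \<le> C * \<bar>y - x\<bar> powr \<alpha>" if "y \<in> S" for y
    using assms(2)[of x y] assms(2)[of y x] that \<open>x \<in> S\<close>
    by (cases "x \<le> y") (auto simp: norm_minus_commute abs_real_def)
  ultimately have "((\<lambda>y. f y - f x) \<longlongrightarrow> 0) (at x within S)"
    by (intro Lim_null_comparison[of "\<lambda>y. f y - f x"]) (auto simp: eventually_at_filter)
  then show "(f \<longlongrightarrow> f x) (at x within S)" by (rule LIM_zero_cancel)
qed

lemma frac_int_continuous_on:
  fixes h :: "real \<Rightarrow> 'a::euclidean_space"
  assumes "0 < \<alpha>" "\<alpha> < 1" and h: "continuous_on {0..T} h"
  shows "continuous_on {0..T} (frac_int \<alpha> h)"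
proof -
  have "bounded (h ` {0..T})"
    using h by (intro compact_imp_bounded compact_continuous_image) auto
  then obtain M where M: "\<And>s. s \<in> {0..T} \<Longrightarrow> norm (h s) \<le> M"
    unfolding bounded_iff by blast
  have "norm (frac_int \<alpha> h y - frac_int \<alpha> h x) \<le> 2 * M / \<alpha> * (y - x) powr \<alpha>"
    if "x \<in> {0..T}" "y \<in> {0..T}" "x \<le> y" for x y
    using that assms(1,2) by (intro frac_int_holder M continuous_on_subset[OF h]) auto
  then show ?thesis by (rule holder_imp_continuous_on[OF assms(1)])
qed

lemma marchaud_weight_has_integral:
  fixes \<alpha> t c d :: real
  assumes "0 < \<alpha>" "c \<le> d" "d < t"
  shows "((\<lambda>s. (t - s) powr (- \<alpha> - 1)) has_integral ((t - d) powr - \<alpha> - (t - c) powr - \<alpha>) / \<alpha>) {c..d}"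
proof -
  have "((\<lambda>s. (t - s) powr (- \<alpha> - 1)) has_integral
      ((t - d) powr - \<alpha> / \<alpha> - (t - c) powr - \<alpha> / \<alpha>)) {c..d}"
    using assms
    by (intro fundamental_theorem_of_calculus_interior)
       (auto intro!: continuous_intros derivative_eq_intros
             simp: has_real_derivative_iff_has_vector_derivative[symmetric] powr_diff)
  then show ?thesis by (simp add: diff_divide_distrib)
qed

text \<open>
  The left-hand side is the truncated Marchaud derivative, with the opposite sign, of a function
  whose value at distance \<open>\<tau>\<close> in the past exceeds the present one by \<open>min 1 (\<kappa> * \<tau>)\<close>. The bound
  is uniform in \<open>\<epsilon>\<close> and \<open>t\<close> and vanishes as \<open>\<kappa> \<rightarrow> 0\<close>. The cap \<open>1\<close> makes the weight
  \<open>\<tau> powr (- \<alpha> - 1)\<close> integrable at infinity and the linear part makes it integrable at \<open>0\<close>, so the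
  interval is split where the two meet.
\<close>

lemma marchaud_weight_capped_linear_le:
  fixes \<alpha> \<kappa> t \<epsilon> :: real
  assumes "0 < \<alpha>" "\<alpha> < 1" "0 < \<kappa>" "0 < \<epsilon>" "\<epsilon> < t" "\<epsilon> < 1 / \<kappa>"
  shows "t powr - \<alpha> * min 1 (\<kappa> * t)
      + \<alpha> * integral {0..t - \<epsilon>} (\<lambda>s. (t - s) powr (- \<alpha> - 1) * min 1 (\<kappa> * (t - s)))
      \<le> \<kappa> powr \<alpha> / (1 - \<alpha>)"
proof -
  let ?f = "\<lambda>s. (t - s) powr (- \<alpha> - 1) * min 1 (\<kappa> * (t - s))"
  \<comment> \<open>\<open>d\<close> is the distance from \<open>t\<close> up to which the linear part of the cap is active.\<close>
  define d where "d = min t (1 / \<kappa>)"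
  define c where "c = t - d"
  have d: "0 < d" "d \<le> 1 / \<kappa>" "d \<le> t" "\<epsilon> < d" using assms by (auto simp: d_def)
  have c: "0 \<le> c" "c \<le> t - \<epsilon>" "c < t" using d assms by (auto simp: c_def)
  have int: "?f integrable_on {0..t - \<epsilon>}"
    using assms by (intro integrable_continuous_real continuous_intros) auto
  have W: "((\<lambda>s. (t - s) powr (- \<alpha> - 1)) has_integral (d powr - \<alpha> - t powr - \<alpha>) / \<alpha>) {0..c}"
    using marchaud_weight_has_integral[of \<alpha> 0 c t] assms c by (simp add: c_def)
  have V: "((\<lambda>s. \<kappa> * (t - s) powr (1 - \<alpha> - 1)) has_integral \<kappa> * ((d powr (1 - \<alpha>) - \<epsilon> powr (1 - \<alpha>)) / (1 - \<alpha>))) {c..t - \<epsilon>}"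
    using kernel_has_integral[of "1 - \<alpha>" c "t - \<epsilon>" t] assms c
    by (intro has_integral_mult_right) (simp add: c_def)
  have "integral {0..t - \<epsilon>} ?f = integral {0..c} ?f + integral {c..t - \<epsilon>} ?f"
    using int c by (simp add: Henstock_Kurzweil_Integration.integral_combine)
  also have "\<dots> \<le> (d powr - \<alpha> - t powr - \<alpha>) / \<alpha> + \<kappa> * ((d powr (1 - \<alpha>) - \<epsilon> powr (1 - \<alpha>)) / (1 - \<alpha>))"
  proof (intro add_mono)
    show "integral {0..c} ?f \<le> (d powr - \<alpha> - t powr - \<alpha>) / \<alpha>"
      unfolding integral_unique[OF W, symmetric]
      using W c by (intro integral_le integrable_subinterval_real[OF int])
        (auto simp: has_integral_iff mult_left_le)
    show "integral {c..t - \<epsilon>} ?f \<le> \<kappa> * ((d powr (1 - \<alpha>) - \<epsilon> powr (1 - \<alpha>)) / (1 - \<alpha>))"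
      unfolding integral_unique[OF V, symmetric]
    proof (intro integral_le integrable_subinterval_real[OF int])
      fix s assume s: "s \<in> {c..t - \<epsilon>}"
      then have "0 < t - s" using assms by auto
      then have e: "(t - s) powr (- \<alpha> - 1) * (t - s) = (t - s) powr (- \<alpha>)"
        by (simp add: powr_diff)
      have "?f s \<le> (t - s) powr (- \<alpha> - 1) * (\<kappa> * (t - s))"
        by (intro mult_left_mono) auto
      also have "\<dots> = \<kappa> * (t - s) powr (1 - \<alpha> - 1)" using e by (simp add: mult_ac)
      finally show "?f s \<le> \<kappa> * (t - s) powr (1 - \<alpha> - 1)" .
    qed (use V c in \<open>auto simp: has_integral_iff\<close>)
  qed
  also have "\<dots> \<le> (d powr - \<alpha> - t powr - \<alpha>) / \<alpha> + \<kappa> * (d powr (1 - \<alpha>) / (1 - \<alpha>))"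
    using assms by (intro add_left_mono mult_left_mono divide_right_mono) auto
  finally have I: "\<alpha> * integral {0..t - \<epsilon>} ?f
      \<le> d powr - \<alpha> - t powr - \<alpha> + \<alpha> / (1 - \<alpha>) * (\<kappa> * d powr (1 - \<alpha>))"
    using assms(1) by (simp add: field_simps)
  have "\<kappa> * d powr (1 - \<alpha>) \<le> \<kappa> * (1 / \<kappa>) powr (1 - \<alpha>)"
    using d assms by (intro mult_left_mono powr_mono2) auto
  also have "\<dots> = \<kappa> powr \<alpha>"
    using assms by (simp add: powr_divide powr_diff)
  finally have J: "\<kappa> * d powr (1 - \<alpha>) \<le> \<kappa> powr \<alpha>" .
  have K: "t powr - \<alpha> * min 1 (\<kappa> * t) + d powr - \<alpha> - t powr - \<alpha> \<le> \<kappa> powr \<alpha>"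
  proof (cases "\<kappa> * t \<le> 1")
    case True
    then have "d = t" using assms by (auto simp: d_def field_simps)
    have "t powr - \<alpha> * t = t powr (1 - \<alpha>)"
      using assms powr_add[of t "-\<alpha>" 1] by simp
    then have e: "t powr - \<alpha> * (\<kappa> * t) = \<kappa> * t powr (1 - \<alpha>)"
      by (metis mult.left_commute)
    have "min 1 (\<kappa> * t) = \<kappa> * t" using True by simp
    then show ?thesis using J e \<open>d = t\<close> by (simp only:)
  next
    case False
    then have "d = 1 / \<kappa>" using assms by (auto simp: d_def field_simps)
    then show ?thesis using False assms by (simp add: powr_divide powr_minus_divide)
  qed
  have "\<kappa> powr \<alpha> + \<alpha> / (1 - \<alpha>) * \<kappa> powr \<alpha> = \<kappa> powr \<alpha> / (1 - \<alpha>)"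
    using assms by (simp add: field_simps)
  moreover have "\<alpha> / (1 - \<alpha>) * (\<kappa> * d powr (1 - \<alpha>)) \<le> \<alpha> / (1 - \<alpha>) * \<kappa> powr \<alpha>"
    using J assms by (intro mult_left_mono) auto
  ultimately show ?thesis using I K by linarith
qed

text \<open>
  The function \<open>P\<close> has the fractional derivative \<open>q\<close>. If \<open>P\<close> were smooth and had a maximum at the right
  end \<open>t\<close> of its interval, then \<open>q t \<ge> 0\<close>, since the Marchaud form of the derivative at \<open>t\<close>
  averages the differences \<open>P t - P s\<close> with positive weights. Here the past may exceed \<open>P t\<close> by a
  slowly growing capped amount, and the price is a correction that is small for small \<open>\<kappa>\<close>.

  Since \<open>q\<close> is merely continuous, \<open>P\<close> is in general only Hoelder continuous of order \<open>\<alpha>\<close> and the Marchaud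
  integral need not converge. So the integral is truncated at distance \<open>\<epsilon>\<close> from \<open>t\<close>. After swapping
  integrals the truncated derivative, up to a positive constant, is \<open>1 / Gamma \<alpha>\<close> times
  the integral of \<open>q\<close> against a nonnegative kernel. This kernel has mass \<open>1 / \<alpha>\<close> on \<open>{t - \<epsilon>..t}\<close>, and at distance at least \<open>\<delta>\<close>
  from \<open>t\<close> it is of order \<open>\<epsilon> powr (1 - \<alpha>)\<close>. Hence a value \<open>q t < - \<beta>\<close> makes the truncated
  derivative at most \<open>- \<beta> / (\<alpha> * Gamma \<alpha>)\<close> in the limit.
\<close>

lemma fractional_near_maximum_principle:
  fixes q :: "real \<Rightarrow> real"
  assumes "0 < \<alpha>" "\<alpha> < 1" "0 < \<kappa>" "0 \<le> B" "0 < t" and q: "continuous_on {0..t} q"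
    and P: "\<And>s. P s = p0 + frac_int \<alpha> q s / Gamma \<alpha>"
    and near_max: "\<And>s. s \<in> {0..<t} \<Longrightarrow> P s \<le> P t + B * min 1 (\<kappa> * (t - s))"
  shows "- q t \<le> \<alpha> * Gamma \<alpha> * (B * \<kappa> powr \<alpha> / (1 - \<alpha>))"
proof (rule ccontr)
  let ?X = "B * \<kappa> powr \<alpha> / (1 - \<alpha>)"
  have G: "0 < Gamma \<alpha>" using assms by (simp add: Gamma_real_pos)
  have X0: "0 \<le> \<alpha> * Gamma \<alpha> * ?X" using assms G by simp
  assume "\<not> ?thesis"
  then obtain \<beta> where \<beta>: "\<alpha> * Gamma \<alpha> * ?X < \<beta>" "\<beta> < - q t"
    using dense[of "\<alpha> * Gamma \<alpha> * ?X" "- q t"] by auto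
  have "0 < \<beta>" using \<beta> X0 by linarith
  obtain \<delta> where \<delta>: "0 < \<delta>" "\<delta> \<le> t" "\<And>s. s \<in> {t - \<delta>..t} \<Longrightarrow> q s \<le> - \<beta>"
  proof -
    obtain d where d: "0 < d" "\<And>s. s \<in> {0..t} \<Longrightarrow> dist s t < d \<Longrightarrow> dist (q s) (q t) < - \<beta> - q t"
      using q[unfolded continuous_on_iff, rule_format, of t "- \<beta> - q t"] \<beta> \<open>0 < t\<close> by auto
    have "q s \<le> - \<beta>" if "s \<in> {t - min t (d / 2)..t}" for s
      using d(2)[of s] that \<open>0 < d\<close> by (auto simp: dist_real_def min_def split: if_splits)
    then show ?thesis using that[of "min t (d / 2)"] d \<open>0 < t\<close> by auto
  qed
  have "bounded (q ` {0..t})"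
    using q by (intro compact_imp_bounded compact_continuous_image) auto
  then obtain M where M: "\<And>s. s \<in> {0..t} \<Longrightarrow> \<bar>q s\<bar> \<le> M"
    unfolding bounded_iff real_norm_def by blast
  have M0: "0 \<le> M" using M[of 0] assms by auto
  \<comment> \<open>\<open>\<epsilon> powr (1 - \<alpha>) * N\<close> bounds what the times before \<open>t - \<delta>\<close> contribute: there the kernel is at most \<open>\<alpha> * \<epsilon> powr (1 - \<alpha>) * (\<delta> / 2) powr (\<alpha> - 1) / \<delta>\<close> by the tangent bound for powers.\<close>
  define N where "N = \<alpha> * (\<delta> / 2) powr (\<alpha> - 1) / \<delta> * M * t"
  have N0: "0 \<le> N" unfolding N_def using assms M0 \<delta> by auto
  have key: "\<beta> / \<alpha> - \<epsilon> powr (1 - \<alpha>) * N \<le> Gamma \<alpha> * ?X"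
    if \<epsilon>: "0 < \<epsilon>" "\<epsilon> < \<delta> / 2" "\<epsilon> < 1 / \<kappa>" for \<epsilon>
  proof -
    define T where "T = t - \<epsilon>"
    have T: "0 < T" "T < t" "t - T = \<epsilon>" using \<epsilon> \<delta> by (auto simp: T_def)
    let ?w = "\<lambda>s. (t - s) powr (- \<alpha> - 1)"
    let ?m = "\<lambda>s. min 1 (\<kappa> * (t - s))"
    have qT: "continuous_on {0..T} q" using T by (intro continuous_on_subset[OF q]) auto
    have Jc: "continuous_on {0..T} (frac_int \<alpha> q)"
      using frac_int_continuous_on[OF assms(1,2) qT] .
    have wc: "continuous_on {0..T} ?w" using T by (intro continuous_intros) auto
    have "P = (\<lambda>s. p0 + frac_int \<alpha> q s / Gamma \<alpha>)" by (simp add: P fun_eq_iff)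
    then have Pc: "continuous_on {0..T} P"
      using G by (auto intro!: continuous_intros Jc)
    have W: "\<alpha> * integral {0..T} ?w = \<epsilon> powr - \<alpha> - t powr - \<alpha>"
      using integral_unique[OF marchaud_weight_has_integral[of \<alpha> 0 T t]] T assms by simp
    have P0: "P 0 = p0" by (simp add: P frac_int_def)
    \<comment> \<open>The past values of \<open>P\<close> are replaced by \<open>P t\<close> plus the allowed excess; as the weights of the truncated derivative sum to zero, the terms with \<open>P t\<close> cancel and only the excess remains in \<open>lhs\<close>.\<close>
    have "\<alpha> * integral {0..T} (\<lambda>s. ?w s * P s)
        \<le> \<alpha> * integral {0..T} (\<lambda>s. ?w s * (P t + B * ?m s))"
      using assms(1) near_max T
      by (intro mult_left_mono integral_le integrable_continuous_real continuous_on_mult wc Pc)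
         (auto intro!: continuous_intros mult_left_mono)
    also have "integral {0..T} (\<lambda>s. ?w s * (P t + B * ?m s))
        = integral {0..T} (\<lambda>s. P t * ?w s + B * (?w s * ?m s))"
      by (simp add: algebra_simps)
    also have "\<dots> = P t * integral {0..T} ?w + B * integral {0..T} (\<lambda>s. ?w s * ?m s)"
      by (subst integral_add) (auto intro!: integrable_continuous_real continuous_intros wc)
    finally have upper: "\<alpha> * integral {0..T} (\<lambda>s. ?w s * P s)
        \<le> P t * (\<epsilon> powr - \<alpha> - t powr - \<alpha>) + B * (\<alpha> * integral {0..T} (\<lambda>s. ?w s * ?m s))"
      unfolding W[symmetric] by (simp add: distrib_left mult_ac)
    have "t powr - \<alpha> * p0 \<le> t powr - \<alpha> * (P t + B * ?m 0)"
      using near_max[of 0] P0 assms by (intro mult_left_mono) auto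
    moreover have "B * (t powr - \<alpha> * ?m 0 + \<alpha> * integral {0..T} (\<lambda>s. ?w s * ?m s))
        \<le> B * (\<kappa> powr \<alpha> / (1 - \<alpha>))"
      using marchaud_weight_capped_linear_le[of \<alpha> \<kappa> \<epsilon> t] assms \<epsilon> \<delta>
      by (intro mult_left_mono) (auto simp: T_def)
    ultimately have lhs: "\<epsilon> powr - \<alpha> * P t - \<alpha> * integral {0..T} (\<lambda>s. ?w s * P s) - t powr - \<alpha> * p0
        \<ge> - ?X"
      using upper by (simp add: algebra_simps)
    have "integral {0..T} (\<lambda>s. ?w s * P s)
        = integral {0..T} (\<lambda>s. p0 * ?w s + (?w s * frac_int \<alpha> q s) / Gamma \<alpha>)"
      by (simp add: P algebra_simps)
    also have "\<dots> = p0 * integral {0..T} ?w + integral {0..T} (\<lambda>s. ?w s * frac_int \<alpha> q s) / Gamma \<alpha>"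
      by (subst integral_add)
         (use G in \<open>auto intro!: integrable_continuous_real continuous_intros wc Jc simp: divide_inverse\<close>)
    finally have "\<alpha> * integral {0..T} (\<lambda>s. ?w s * P s)
        = p0 * (\<epsilon> powr - \<alpha> - t powr - \<alpha>) + \<alpha> * integral {0..T} (\<lambda>s. ?w s * frac_int \<alpha> q s) / Gamma \<alpha>"
      unfolding W[symmetric] by (simp add: distrib_left mult_ac)
    then have "\<epsilon> powr - \<alpha> * P t - \<alpha> * integral {0..T} (\<lambda>s. ?w s * P s) - t powr - \<alpha> * p0
        = (\<epsilon> powr - \<alpha> * frac_int \<alpha> q t - \<alpha> * integral {0..T} (\<lambda>s. ?w s * frac_int \<alpha> q s)) / Gamma \<alpha>"
      by (simp add: P[of t] algebra_simps diff_divide_distrib)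
    with lhs have main: "- (Gamma \<alpha> * ?X)
        \<le> \<epsilon> powr - \<alpha> * frac_int \<alpha> q t - \<alpha> * integral {0..T} (\<lambda>s. ?w s * frac_int \<alpha> q s)"
      by (simp only: pos_le_divide_eq[OF G] mult_minus_left mult.commute)
    \<comment> \<open>The same quantity as an integral of \<open>q\<close> against the nonnegative kernel: \<open>?k\<close> on \<open>{T..t}\<close> and a difference quotient of powers on \<open>{0..T}\<close>, both scaled by \<open>\<epsilon> powr - \<alpha>\<close>.\<close>
    let ?k = "\<lambda>s. (t - s) powr (\<alpha> - 1) * q s"
    let ?k2 = "\<lambda>s. ((T - s) / \<epsilon>) powr \<alpha> / (\<alpha> * (t - s)) * q s"
    have swap: "integral {0..T} (\<lambda>s. ?w s * frac_int \<alpha> q s) = integral {0..T} ?k2"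
      using truncated_marchaud_integral_swap[OF assms(1) _ T(2) qT] T by (simp add: frac_int_def)
    have kint: "?k integrable_on {0..t}"
      using kernel_absolutely_integrable[OF assms(1) _ order_refl q] assms(5)
      by (intro set_lebesgue_integral_eq_integral(1)) auto
    have k2int: "?k2 integrable_on {0..T}"
      using assms T \<epsilon> by (intro integrable_continuous_real continuous_intros continuous_on_powr' qT) auto
    have kT: "?k integrable_on {0..T}" "?k integrable_on {T..t}"
      using T by (auto intro: integrable_subinterval_real[OF kint])
    have "frac_int \<alpha> q t = integral {0..T} ?k + integral {T..t} ?k"
      unfolding frac_int_def using kint T by (simp add: Henstock_Kurzweil_Integration.integral_combine)
    then have "\<epsilon> powr - \<alpha> * frac_int \<alpha> q t - \<alpha> * integral {0..T} (\<lambda>s. ?w s * frac_int \<alpha> q s)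
        = \<epsilon> powr - \<alpha> * integral {T..t} ?k + (integral {0..T} (\<lambda>s. \<epsilon> powr - \<alpha> * ?k s) - integral {0..T} (\<lambda>s. \<alpha> * ?k2 s))"
      unfolding swap integral_mult_right by (simp only: distrib_left)
    also have "\<dots> = \<epsilon> powr - \<alpha> * integral {T..t} ?k + integral {0..T} (\<lambda>s. \<epsilon> powr - \<alpha> * ?k s - \<alpha> * ?k2 s)"
      by (subst integral_diff[OF integrable_on_mult_right[OF kT(1)] integrable_on_mult_right[OF k2int]]) (rule refl)
    also have "\<dots> \<le> - \<beta> / \<alpha> + integral {0..T} (\<lambda>s. \<epsilon> powr (1 - \<alpha>) * (N / t))"
    proof (intro add_mono integral_le)
      have H: "((\<lambda>s. (t - s) powr (\<alpha> - 1) * (- \<beta>)) has_integral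
          (((t - T) powr \<alpha> - (t - t) powr \<alpha>) / \<alpha>) * (- \<beta>)) {T..t}"
        using T by (intro has_integral_mult_left kernel_has_integral assms) auto
      have "integral {T..t} ?k \<le> (((t - T) powr \<alpha> - (t - t) powr \<alpha>) / \<alpha>) * (- \<beta>)"
        unfolding integral_unique[OF H, symmetric]
      proof (rule integral_le[OF kT(2) has_integral_integrable[OF H]])
        fix s assume "s \<in> {T..t}"
        then have "q s \<le> - \<beta>" using \<epsilon> \<delta> T by (intro \<delta>(3)) auto
        then show "?k s \<le> (t - s) powr (\<alpha> - 1) * (- \<beta>)" by (intro mult_left_mono) auto
      qed
      then have "\<epsilon> powr - \<alpha> * integral {T..t} ?k \<le> \<epsilon> powr - \<alpha> * (\<epsilon> powr \<alpha> / \<alpha> * (- \<beta>))"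
        using T by (intro mult_left_mono) auto
      also have "\<dots> = - \<beta> / \<alpha>" using \<epsilon> by (simp add: powr_minus field_simps)
      finally show "\<epsilon> powr - \<alpha> * integral {T..t} ?k \<le> - \<beta> / \<alpha>" .
    next
      show "(\<lambda>s. \<epsilon> powr - \<alpha> * ?k s - \<alpha> * ?k2 s) integrable_on {0..T}"
        by (intro integrable_diff integrable_on_mult_right kT(1) k2int)
    next
      fix s assume s: "s \<in> {0..T}"
      then have pos: "0 \<le> T - s" "0 < t - s" "t - s = T - s + \<epsilon>" using T by auto
      have eq: "\<epsilon> powr - \<alpha> * ?k s - \<alpha> * ?k2 s
          = \<epsilon> powr - \<alpha> * ((t - s) powr \<alpha> - (T - s) powr \<alpha>) / (t - s) * q s"
      proof -
        have e: "(t - s) powr (\<alpha> - 1) = (t - s) powr \<alpha> / (t - s)"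
          "((T - s) / \<epsilon>) powr \<alpha> = \<epsilon> powr - \<alpha> * (T - s) powr \<alpha>"
          using pos \<epsilon> by (simp_all add: powr_diff powr_divide powr_minus_divide)
        have "e * (v / x * y) - \<alpha> * (e * u / (\<alpha> * x) * y) = e * (v - u) / x * y"
          if "0 < x" for e v u x y :: real
          using that assms(1) by (simp add: field_simps)
        from this[OF pos(2)] show ?thesis unfolding e .
      qed
      have dnn: "0 \<le> (t - s) powr \<alpha> - (T - s) powr \<alpha>"
        using pos assms \<epsilon> by (simp add: powr_mono2)
      show "\<epsilon> powr - \<alpha> * ?k s - \<alpha> * ?k2 s \<le> \<epsilon> powr (1 - \<alpha>) * (N / t)"
      proof (cases "t - \<delta> \<le> s")
        case True
        then have "q s \<le> 0" using \<delta>(3)[of s] s T \<open>0 < \<beta>\<close> by auto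
        then have "\<epsilon> powr - \<alpha> * ?k s - \<alpha> * ?k2 s \<le> 0"
          unfolding eq using dnn pos(2)
          by (intro mult_nonneg_nonpos divide_nonneg_pos mult_nonneg_nonneg powr_ge_zero)
        also have "0 \<le> \<epsilon> powr (1 - \<alpha>) * (N / t)" using N0 assms by auto
        finally show ?thesis .
      next
        case False
        then have far: "\<delta> / 2 \<le> T - s" "\<delta> \<le> t - s" using \<epsilon> T by auto
        have "(t - s) powr \<alpha> - (T - s) powr \<alpha> \<le> \<alpha> * \<epsilon> * (T - s) powr (\<alpha> - 1)"
        proof -
          have "t - s - (T - s) = \<epsilon>" "0 < T - s" "T - s \<le> t - s"
            using T far \<delta>(1) by auto
          then show ?thesis
            using powr_diff_le_tangent[OF assms(1,2), of "T - s" "t - s"] by (simp only:)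
        qed
        also have "\<dots> \<le> \<alpha> * \<epsilon> * (\<delta> / 2) powr (\<alpha> - 1)"
          using far \<delta> \<epsilon> assms by (intro mult_left_mono powr_mono2') auto
        finally have d: "(t - s) powr \<alpha> - (T - s) powr \<alpha> \<le> \<alpha> * \<epsilon> * (\<delta> / 2) powr (\<alpha> - 1)" .
        have "\<epsilon> powr - \<alpha> * ((t - s) powr \<alpha> - (T - s) powr \<alpha>) / (t - s) * q s
            \<le> \<epsilon> powr - \<alpha> * ((t - s) powr \<alpha> - (T - s) powr \<alpha>) / (t - s) * M"
          using M[of s] s T dnn pos(2)
          by (intro mult_left_mono divide_nonneg_pos mult_nonneg_nonneg powr_ge_zero) auto
        also have "\<dots> \<le> \<epsilon> powr - \<alpha> * (\<alpha> * \<epsilon> * (\<delta> / 2) powr (\<alpha> - 1)) / \<delta> * M"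
          using far(2) \<delta>(1) \<epsilon>(1) assms(1)
          by (intro mult_right_mono frac_le mult_left_mono d M0) auto
        also have "\<dots> = \<epsilon> powr (1 - \<alpha>) * (N / t)"
          using \<epsilon> assms by (simp add: N_def powr_diff powr_minus field_simps)
        finally show ?thesis unfolding eq .
      qed
    qed auto
    also have "\<dots> \<le> - \<beta> / \<alpha> + \<epsilon> powr (1 - \<alpha>) * N"
    proof -
      have "integral {0..T} (\<lambda>s. \<epsilon> powr (1 - \<alpha>) * (N / t)) = \<epsilon> powr (1 - \<alpha>) * N * (T / t)"
        using T by simp
      also have "\<dots> \<le> \<epsilon> powr (1 - \<alpha>) * N" using T N0 assms by (intro mult_left_le) auto
      finally show ?thesis by simp
    qed
    finally show ?thesis using main by linarith
  qed
  have "((\<lambda>\<epsilon>. \<beta> / \<alpha> - \<epsilon> powr (1 - \<alpha>) * N) \<longlongrightarrow> \<beta> / \<alpha> - 0 powr (1 - \<alpha>) * N) (at_right 0)"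
    using assms by (intro tendsto_intros tendsto_powr') (auto simp: eventually_at_filter)
  moreover have "\<forall>\<^sub>F \<epsilon> in at_right 0. \<epsilon> \<in> {0<..<min (\<delta> / 2) (1 / \<kappa>)}"
    using \<delta> assms by (intro eventually_at_right_real) auto
  then have "\<forall>\<^sub>F \<epsilon> in at_right 0. \<beta> / \<alpha> - \<epsilon> powr (1 - \<alpha>) * N \<le> Gamma \<alpha> * ?X"
    by eventually_elim (use key in auto)
  ultimately have "\<beta> / \<alpha> - 0 powr (1 - \<alpha>) * N \<le> Gamma \<alpha> * ?X"
    by (rule tendsto_upperbound) simp
  then show False using \<beta> assms by (simp add: field_simps)
qed

section \<open>A moving barrier for dissipative equations\<close>

lemma first_zero_from_below:
  fixes p :: "real \<Rightarrow> real"
  assumes p: "continuous_on {0..T} p" and "p 0 < 0" "0 \<le> T" "0 \<le> p T"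
  obtains t where "0 < t" "t \<le> T" "p t = 0" "\<And>s. 0 \<le> s \<Longrightarrow> s < t \<Longrightarrow> p s < 0"
proof -
  define S where "S = {s \<in> {0..T}. 0 \<le> p s}"
  have "S = {0..T} \<inter> p -` {0..}" by (auto simp: S_def)
  then have "closed S" using continuous_closed_preimage[OF p, of "{0..}"] by simp
  moreover have "bounded S"
    by (rule bounded_subset[OF bounded_closed_interval[of 0 T]]) (auto simp: S_def)
  ultimately have "compact S" by (simp add: compact_eq_bounded_closed)
  moreover have "T \<in> S" using assms by (simp add: S_def)
  ultimately obtain t where t: "t \<in> S" "\<And>s. s \<in> S \<Longrightarrow> t \<le> s"
    using compact_attains_inf[of S] by auto
  have tT: "0 \<le> t" "t \<le> T" "0 \<le> p t" using t by (auto simp: S_def)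
  then obtain s where s: "0 \<le> s" "s \<le> t" "p s = 0"
    using IVT'[of p 0 0 t] assms(2) continuous_on_subset[OF p, of "{0..t}"] by auto
  then have "s = t" using t(2)[of s] tT by (simp add: S_def)
  show ?thesis
  proof (rule that)
    show "p t = 0" using s \<open>s = t\<close> by simp
    then show "0 < t" using tT assms(2) by (cases "t = 0") auto
    show "p s < 0" if "0 \<le> s" "s < t" for s
      using t(2)[of s] that tT by (force simp: S_def)
  qed (use tT in auto)
qed

lemma frac_int_inner:
  fixes h :: "real \<Rightarrow> 'a::euclidean_space"
  assumes "0 < \<alpha>" "0 \<le> t" "continuous_on {0..t} h"
  shows "frac_int \<alpha> (\<lambda>s. v \<bullet> h s) t = v \<bullet> frac_int \<alpha> h t"
proof -
  have "(\<lambda>s. (t - s) powr (\<alpha> - 1) *\<^sub>R h s) integrable_on {0..t}"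
    using assms by (intro set_lebesgue_integral_eq_integral(1) kernel_absolutely_integrable) auto
  from integral_linear[OF this bounded_linear_inner_right[of v]]
  show ?thesis by (simp add: frac_int_def o_def)
qed

text \<open>
  The barrier \<open>A + B * max 0 (1 - \<kappa> * s)\<close> decreases linearly from \<open>A + B\<close> to \<open>A\<close> and then stays
  there. Suppose the squared norm touches it for the first time at \<open>t\<close>. As
  \<open>x t \<bullet> x s \<le> ((norm (x t))\<^sup>2 + (norm (x s))\<^sup>2) / 2\<close>, the scalar function \<open>s \<mapsto> x t \<bullet> x s\<close> then
  nearly has a maximum at \<open>t\<close> in the sense of the fractional maximum principle. Its fractional
  derivative is \<open>x t \<bullet> h s\<close>, so the maximum principle bounds \<open>x t \<bullet> h t\<close> from below and contradicts
  the assumption that \<open>h\<close> points inward on the barrier. Passing to the scalar function replaces the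
  chain rule inequality for the fractional derivative of \<open>(norm (x s))\<^sup>2\<close>.
\<close>

lemma dissipative_barrier:
  fixes x h :: "real \<Rightarrow> 'a::euclidean_space"
  assumes "0 < \<alpha>" "\<alpha> < 1" "0 < \<kappa>" "0 \<le> B" "0 \<le> T"
    and h: "continuous_on {0..T} h"
    and x: "\<And>s. s \<in> {0..T} \<Longrightarrow> x s = x0 + (1 / Gamma \<alpha>) *\<^sub>R frac_int \<alpha> h s"
    and init: "(norm x0)\<^sup>2 < A + B"
    and inward: "\<And>s. s \<in> {0..T} \<Longrightarrow> (norm (x s))\<^sup>2 = A + B * max 0 (1 - \<kappa> * s) \<Longrightarrow>
        x s \<bullet> h s < - (\<alpha> * Gamma \<alpha> * (B * \<kappa> powr \<alpha> / (1 - \<alpha>)))"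
  shows "(norm (x T))\<^sup>2 < A + B * max 0 (1 - \<kappa> * T)"
proof (rule ccontr)
  let ?W = "\<lambda>s. A + B * max 0 (1 - \<kappa> * s)"
  let ?p = "\<lambda>s. (norm (x s))\<^sup>2 - ?W s"
  assume "\<not> ?thesis"
  then have "0 \<le> ?p T" by simp
  have xc: "continuous_on {0..T} x"
  proof (rule continuous_on_eq)
    show "continuous_on {0..T} (\<lambda>s. x0 + (1 / Gamma \<alpha>) *\<^sub>R frac_int \<alpha> h s)"
      by (intro continuous_on_add continuous_on_scaleR continuous_on_const frac_int_continuous_on assms)
  qed (simp add: x)
  have "x 0 = x0" using x[of 0] assms by (simp add: frac_int_def)
  then have "?p 0 < 0" using init by simp
  moreover have "continuous_on {0..T} ?p" by (intro continuous_intros xc)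
  ultimately obtain t where t: "0 < t" "t \<le> T" "?p t = 0" "\<And>s. 0 \<le> s \<Longrightarrow> s < t \<Longrightarrow> ?p s < 0"
    using first_zero_from_below[where p = ?p and T = T] \<open>0 \<le> ?p T\<close> assms(5) by blast
  have ht: "continuous_on {0..s} h" if "s \<le> t" for s
    using that t by (intro continuous_on_subset[OF h]) auto
  define q where "q s = x t \<bullet> h s" for s
  define P where "P s = x t \<bullet> x0 + frac_int \<alpha> q s / Gamma \<alpha>" for s
  have P: "P s = x t \<bullet> x s" if "0 \<le> s" "s \<le> t" for s
    using frac_int_inner[OF assms(1) that(1) ht[OF that(2)], of "x t"] that t x[of s]
    by (simp add: P_def q_def[abs_def] inner_add_right)
  have "- q t \<le> \<alpha> * Gamma \<alpha> * (B * \<kappa> powr \<alpha> / (1 - \<alpha>))"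
  proof (rule fractional_near_maximum_principle[OF assms(1-4) t(1) _ P_def])
    show "continuous_on {0..t} q" unfolding q_def by (intro continuous_intros ht) simp
    fix s assume s: "s \<in> {0..<t}"
    have "0 \<le> (norm (x t - x s))\<^sup>2" by simp
    also have "\<dots> = (norm (x t))\<^sup>2 + (norm (x s))\<^sup>2 - 2 * (x t \<bullet> x s)"
      by (simp add: power2_norm_eq_inner inner_diff inner_commute algebra_simps)
    also have "(norm (x s))\<^sup>2 \<le> (norm (x t))\<^sup>2 + B * (max 0 (1 - \<kappa> * s) - max 0 (1 - \<kappa> * t))"
      using t(3) t(4)[of s] s by (simp add: algebra_simps)
    finally have "x t \<bullet> x s \<le> (norm (x t))\<^sup>2 + B * (max 0 (1 - \<kappa> * s) - max 0 (1 - \<kappa> * t)) / 2"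
      by simp
    moreover have "max 0 (1 - \<kappa> * s) - max 0 (1 - \<kappa> * t) \<le> min 1 (\<kappa> * t - \<kappa> * s)"
    proof -
      have "0 \<le> \<kappa> * s" "\<kappa> * s \<le> \<kappa> * t" using s assms(3) by auto
      then show ?thesis by linarith
    qed
    then have "B * (max 0 (1 - \<kappa> * s) - max 0 (1 - \<kappa> * t)) \<le> B * min 1 (\<kappa> * (t - s))"
      unfolding right_diff_distrib[of \<kappa>] using assms(4) by (rule mult_left_mono)
    moreover have "0 \<le> B * min 1 (\<kappa> * (t - s))" using s assms(3,4) by simp
    ultimately have "x t \<bullet> x s \<le> x t \<bullet> x t + B * min 1 (\<kappa> * (t - s))"
      by (simp add: power2_norm_eq_inner)
    then show "P s \<le> P t + B * min 1 (\<kappa> * (t - s))"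
      using s t(1) by (simp add: P)
  qed
  then show False using inward[of t] t by (simp add: q_def)
qed

section \<open>Existence of solutions\<close>

text \<open>
  After the substitution \<open>u = \<kappa> * (t - s)\<close> the left-hand side is \<open>1 / \<kappa> powr \<alpha>\<close> times a part of
  Euler's integral for \<open>Gamma \<alpha>\<close>.
\<close>

lemma exponential_kernel_integral_le:
  fixes \<alpha> \<kappa> t :: real
  assumes "0 < \<alpha>" "0 < \<kappa>" "0 \<le> t"
  shows "integral {0..t} (\<lambda>s. (t - s) powr (\<alpha> - 1) * exp (- \<kappa> * (t - s))) \<le> Gamma \<alpha> / \<kappa> powr \<alpha>"
proof -
  let ?F = "\<lambda>u :: real. u powr (\<alpha> - 1) / exp u"
  have FG: "(?F has_integral Gamma \<alpha>) {0..}" using Gamma_integral_real[OF assms(1)] .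
  have Fi: "?F integrable_on {0..\<kappa> * t}"
    using has_integral_integrable[OF FG] by (rule integrable_on_subinterval) auto
  have le: "integral {0..\<kappa> * t} ?F \<le> Gamma \<alpha>"
    unfolding integral_unique[OF FG, symmetric]
    using Fi has_integral_integrable[OF FG] by (intro integral_subset_le) auto
  have "((\<lambda>s. ?F (- \<kappa> * s + \<kappa> * t)) has_integral integral {0..\<kappa> * t} ?F / \<kappa>) {0..t}"
  proof -
    have "(\<lambda>s. (1 / - \<kappa>) *\<^sub>R s + - ((1 / - \<kappa>) *\<^sub>R (\<kappa> * t))) ` {0..\<kappa> * t} = (\<lambda>s. (- 1 / \<kappa>) * s + t) ` {0..\<kappa> * t}"
      using assms by (intro image_cong) auto
    also have "\<dots> = {0..t}"
      using assms by (subst image_affinity_atLeastAtMost) (auto simp: divide_le_0_iff)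
    finally show ?thesis
      using has_integral_affinity[OF integrable_integral[OF Fi, folded box_real(2)], of "- \<kappa>" "\<kappa> * t"] assms
      by simp
  qed
  then have H: "((\<lambda>s. \<kappa> powr (1 - \<alpha>) * ?F (- \<kappa> * s + \<kappa> * t)) has_integral
      \<kappa> powr (1 - \<alpha>) * (integral {0..\<kappa> * t} ?F / \<kappa>)) {0..t}"
    by (rule has_integral_mult_right)
  have "\<kappa> powr (1 - \<alpha>) * ?F (- \<kappa> * s + \<kappa> * t) = (t - s) powr (\<alpha> - 1) * exp (- \<kappa> * (t - s))"
    if "s \<in> {0..t}" for s
  proof -
    have "- \<kappa> * s + \<kappa> * t = \<kappa> * (t - s)" by (simp add: algebra_simps)
    moreover have "(\<kappa> * (t - s)) powr (\<alpha> - 1) = \<kappa> powr (\<alpha> - 1) * (t - s) powr (\<alpha> - 1)"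
      using that assms by (simp add: powr_mult)
    moreover have "\<kappa> powr (1 - \<alpha>) * \<kappa> powr (\<alpha> - 1) = 1"
      using assms by (simp add: powr_add[symmetric])
    ultimately show ?thesis
      by (simp add: exp_minus divide_inverse mult.assoc[symmetric])
  qed
  then have "((\<lambda>s. (t - s) powr (\<alpha> - 1) * exp (- \<kappa> * (t - s))) has_integral
      \<kappa> powr (1 - \<alpha>) * (integral {0..\<kappa> * t} ?F / \<kappa>)) {0..t}"
    by (rule has_integral_eq[OF _ H])
  then have "integral {0..t} (\<lambda>s. (t - s) powr (\<alpha> - 1) * exp (- \<kappa> * (t - s)))
      = \<kappa> powr (1 - \<alpha>) * (integral {0..\<kappa> * t} ?F / \<kappa>)"
    by (rule integral_unique)
  also have "\<dots> \<le> \<kappa> powr (1 - \<alpha>) * (Gamma \<alpha> / \<kappa>)"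
    using le assms by (intro mult_left_mono divide_right_mono) auto
  also have "\<dots> = Gamma \<alpha> / \<kappa> powr \<alpha>"
    using assms by (simp add: powr_diff)
  finally show ?thesis .
qed

text \<open>
  Banach's fixed point theorem, applied to \<open>y t = exp (- \<kappa> * t) * x t\<close> so that the bounded
  continuous functions with the supremum norm carry Bielecki's weighted norm. The weight turns the
  Lipschitz constant of the integral operator into \<open>L / \<kappa> powr \<alpha>\<close>, which a large \<open>\<kappa>\<close> makes at most
  \<open>1 / 2\<close> on the whole half-line at once. Arguments \<open>t < 0\<close> are mapped to \<open>0\<close> because bounded
  continuous functions are defined on the whole line.
\<close>

lemma lipschitz_volterra_solution_exists:
  fixes g :: "'a::euclidean_space \<Rightarrow> 'a"
  assumes \<alpha>: "0 < \<alpha>" "\<alpha> < 1"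
    and lip: "L-lipschitz_on UNIV g" and bnd: "\<And>y. norm (g y) \<le> M"
  obtains x where "continuous_on UNIV x"
    "\<And>t. 0 \<le> t \<Longrightarrow> x t = x0 + (1 / Gamma \<alpha>) *\<^sub>R frac_int \<alpha> (\<lambda>s. g (x s)) t"
proof -
  have G: "0 < Gamma \<alpha>" using \<alpha> by (simp add: Gamma_real_pos)
  have L0: "0 \<le> L" using lip by (rule lipschitz_on_nonneg)
  have M0: "0 \<le> M" using bnd[of 0] norm_ge_zero order_trans by blast
  have gc: "continuous_on UNIV g" using lip by (rule lipschitz_on_continuous_on)
  define \<kappa> where "\<kappa> = (2 * L + 1) powr (1 / \<alpha>)"
  have \<kappa>: "0 < \<kappa>" "\<kappa> powr \<alpha> = 2 * L + 1"
    using L0 \<alpha> by (auto simp: \<kappa>_def powr_powr)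
  define h where "h y s = g (exp (\<kappa> * s) *\<^sub>R apply_bcontfun y s)" for y :: "real \<Rightarrow>\<^sub>C 'a" and s
  have hc: "continuous_on S (h y)" for y S
    unfolding h_def[abs_def] using gc
    by (intro continuous_on_compose2[OF gc] continuous_intros) auto
  define F where "F y t = exp (- \<kappa> * max 0 t) *\<^sub>R (x0 + (1 / Gamma \<alpha>) *\<^sub>R frac_int \<alpha> (h y) (max 0 t))"
    for y t
  have I_bound: "norm (frac_int \<alpha> (h y) t) \<le> M * t powr \<alpha> / \<alpha>" if "0 \<le> t" for y t
    using kernel_integral_norm_le[OF \<alpha>(1) that order_refl hc, of y M] \<alpha>(1)
    by (simp add: frac_int_def h_def bnd)
  have F_cont: "continuous_on UNIV (F y)" for y
  proof -
    have "continuous_on {0..} (frac_int \<alpha> (h y))"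
    proof (rule holder_imp_continuous_on[OF \<alpha>(1)])
      show "norm (frac_int \<alpha> (h y) t - frac_int \<alpha> (h y) s) \<le> 2 * M / \<alpha> * (t - s) powr \<alpha>"
        if "s \<in> {0..}" "t \<in> {0..}" "s \<le> t" for s t
        using that by (intro frac_int_holder \<alpha> hc) (auto simp: h_def bnd)
    qed
    then have "continuous_on UNIV (\<lambda>t. frac_int \<alpha> (h y) (max 0 t))"
      by (rule continuous_on_compose2) (auto intro!: continuous_intros)
    then show ?thesis unfolding F_def by (intro continuous_intros)
  qed
  have F_bcontfun: "F y \<in> bcontfun" for y
  proof (rule bcontfun_normI[OF F_cont])
    fix t :: real
    define u where "u = max 0 t"
    have u: "0 \<le> u" by (simp add: u_def)
    have "u powr \<alpha> \<le> 1 + u"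
    proof (cases "u \<le> 1")
      case True
      then have "u powr \<alpha> \<le> 1" using u \<alpha> by (simp add: powr_le1)
      then show ?thesis using u by simp
    next
      case False
      then have "u powr \<alpha> \<le> u powr 1" using \<alpha> by (intro powr_mono) auto
      then show ?thesis using False by simp
    qed
    moreover have "1 + \<kappa> * u \<le> exp (\<kappa> * u)" by (rule exp_ge_add_one_self)
    then have "exp (- (\<kappa> * u)) * (1 + \<kappa> * u) \<le> 1"
      by (simp add: exp_minus field_simps)
    then have "exp (- (\<kappa> * u)) * (1 + u) \<le> 1 + 1 / \<kappa>"
    proof -
      have "1 + u \<le> (1 + 1 / \<kappa>) * (1 + \<kappa> * u)"
        using \<kappa>(1) u by (simp add: field_simps)
      then have "exp (- (\<kappa> * u)) * (1 + u) \<le> exp (- (\<kappa> * u)) * ((1 + 1 / \<kappa>) * (1 + \<kappa> * u))"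
        by (intro mult_left_mono) auto
      also have "\<dots> = (1 + 1 / \<kappa>) * (exp (- (\<kappa> * u)) * (1 + \<kappa> * u))" by simp
      also have "\<dots> \<le> 1 + 1 / \<kappa>"
        using \<open>exp (- (\<kappa> * u)) * (1 + \<kappa> * u) \<le> 1\<close> \<kappa>(1) by (intro mult_left_le) auto
      finally show ?thesis .
    qed
    ultimately have e: "exp (- (\<kappa> * u)) * u powr \<alpha> \<le> 1 + 1 / \<kappa>"
      by (meson exp_ge_zero mult_left_mono order_trans)
    have "norm (x0 + (1 / Gamma \<alpha>) *\<^sub>R frac_int \<alpha> (h y) u)
        \<le> norm x0 + 1 / Gamma \<alpha> * (M * u powr \<alpha> / \<alpha>)"
      using mult_left_mono[OF I_bound[OF u, of y], of "1 / Gamma \<alpha>"] G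
      by (intro order_trans[OF norm_triangle_ineq] add_left_mono) simp
    then have "norm (F y t) \<le> exp (- (\<kappa> * u)) * (norm x0 + 1 / Gamma \<alpha> * (M * u powr \<alpha> / \<alpha>))"
      by (simp add: F_def u_def[symmetric])
    also have "\<dots> = exp (- (\<kappa> * u)) * norm x0 + M / (Gamma \<alpha> * \<alpha>) * (exp (- (\<kappa> * u)) * u powr \<alpha>)"
      by (simp add: field_simps)
    also have "\<dots> \<le> 1 * norm x0 + M / (Gamma \<alpha> * \<alpha>) * (1 + 1 / \<kappa>)"
      using e G \<alpha> M0 \<kappa>(1) u by (intro add_mono mult_right_mono mult_left_mono) auto
    finally show "norm (F y t) \<le> 1 * norm x0 + M / (Gamma \<alpha> * \<alpha>) * (1 + 1 / \<kappa>)" .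
  qed
  define \<Phi> where "\<Phi> y = Bcontfun (F y)" for y
  have \<Phi>: "apply_bcontfun (\<Phi> y) = F y" for y
    unfolding \<Phi>_def by (rule Bcontfun_inverse[OF F_bcontfun])
  have contraction: "dist (\<Phi> y) (\<Phi> z) \<le> 1 / 2 * dist y z" for y z
  proof (rule dist_bound)
    fix t :: real
    define u where "u = max 0 t"
    have u: "0 \<le> u" by (simp add: u_def)
    let ?k = "\<lambda>s. (u - s) powr (\<alpha> - 1)"
    have ki: "(\<lambda>s. ?k s *\<^sub>R f s) integrable_on {0..u}" if "continuous_on {0..u} f" for f :: "real \<Rightarrow> 'b::euclidean_space"
      using kernel_absolutely_integrable[OF \<alpha>(1) u order_refl that]
      by (rule set_lebesgue_integral_eq_integral(1))
    have hdiff: "norm (h y s - h z s) \<le> L * (exp (\<kappa> * s) * dist y z)" for s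
    proof -
      have "norm (h y s - h z s) \<le> L * dist (exp (\<kappa> * s) *\<^sub>R apply_bcontfun y s) (exp (\<kappa> * s) *\<^sub>R apply_bcontfun z s)"
        unfolding h_def using lipschitz_onD[OF lip] by (simp add: dist_norm)
      also have "\<dots> = L * (exp (\<kappa> * s) * dist (apply_bcontfun y s) (apply_bcontfun z s))"
        by (simp add: dist_norm scaleR_diff_right[symmetric])
      also have "\<dots> \<le> L * (exp (\<kappa> * s) * dist y z)"
        using L0 by (intro mult_left_mono dist_bounded) auto
      finally show ?thesis .
    qed
    have "norm (frac_int \<alpha> (h y) u - frac_int \<alpha> (h z) u)
        = norm (integral {0..u} (\<lambda>s. ?k s *\<^sub>R (h y s - h z s)))"
      unfolding frac_int_def scaleR_diff_right by (subst integral_diff) (auto intro: ki hc)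
    also have "\<dots> \<le> integral {0..u} (\<lambda>s. ?k s *\<^sub>R (L * (exp (\<kappa> * s) * dist y z)))"
      using hdiff by (intro integral_norm_bound_integral ki continuous_intros hc) (auto intro!: mult_left_mono)
    also have "\<dots> = integral {0..u} (\<lambda>s. (L * exp (\<kappa> * u) * dist y z) * (?k s * exp (- \<kappa> * (u - s))))"
      by (intro integral_cong) (simp add: exp_add[symmetric] algebra_simps)
    also have "\<dots> = (L * exp (\<kappa> * u) * dist y z) * integral {0..u} (\<lambda>s. ?k s * exp (- \<kappa> * (u - s)))"
      by (rule integral_mult_right)
    also have "\<dots> \<le> (L * exp (\<kappa> * u) * dist y z) * (Gamma \<alpha> / \<kappa> powr \<alpha>)"
      using L0 by (intro mult_left_mono exponential_kernel_integral_le \<alpha> \<kappa> u) auto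
    finally have D: "norm (frac_int \<alpha> (h y) u - frac_int \<alpha> (h z) u)
        \<le> (L * exp (\<kappa> * u) * dist y z) * (Gamma \<alpha> / \<kappa> powr \<alpha>)" .
    have "F y t - F z t = (exp (- \<kappa> * u) / Gamma \<alpha>) *\<^sub>R (frac_int \<alpha> (h y) u - frac_int \<alpha> (h z) u)"
      by (simp add: F_def u_def[symmetric] algebra_simps)
    then have "dist (F y t) (F z t) = exp (- \<kappa> * u) / Gamma \<alpha> * norm (frac_int \<alpha> (h y) u - frac_int \<alpha> (h z) u)"
      using G by (simp add: dist_norm)
    also have "\<dots> \<le> exp (- \<kappa> * u) / Gamma \<alpha> * ((L * exp (\<kappa> * u) * dist y z) * (Gamma \<alpha> / \<kappa> powr \<alpha>))"
      using D G by (intro mult_left_mono) auto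
    also have "\<dots> = L / (2 * L + 1) * dist y z"
      using G \<kappa>(2) by (simp add: exp_minus)
    also have "\<dots> \<le> 1 / 2 * dist y z"
      using L0 by (intro mult_right_mono) (auto simp: field_simps)
    finally show "dist (apply_bcontfun (\<Phi> y) t) (apply_bcontfun (\<Phi> z) t) \<le> 1 / 2 * dist y z"
      by (simp add: \<Phi>)
  qed
  then obtain y where y: "\<Phi> y = y"
    using banach_fix_type[of "1 / 2" \<Phi>] by auto
  define x where "x s = exp (\<kappa> * s) *\<^sub>R apply_bcontfun y s" for s
  show ?thesis
  proof (rule that)
    show "continuous_on UNIV x" unfolding x_def by (intro continuous_intros) auto
    fix t :: real assume "0 \<le> t"
    have "h y = (\<lambda>s. g (x s))" by (simp add: h_def x_def fun_eq_iff)
    moreover have "apply_bcontfun y t = F y t" using \<Phi>[of y] y by simp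
    ultimately show "x t = x0 + (1 / Gamma \<alpha>) *\<^sub>R frac_int \<alpha> (\<lambda>s. g (x s)) t"
      using \<open>0 \<le> t\<close> by (simp add: x_def F_def exp_minus)
  qed
qed

text \<open>
  Composing \<open>g\<close> with the projection to a large ball makes it bounded and globally Lipschitz. A
  solution of the modified equation cannot leave the ball: on the sphere \<open>g\<close> points strictly inward,
  so the barrier with the constant height \<open>A\<close> (that is, \<open>B = 0\<close>) applies. Inside the ball the
  modification is invisible.
\<close>

lemma dissipative_volterra_solution_exists:
  fixes g :: "real ^ 'n \<Rightarrow> real ^ 'n"
  assumes \<alpha>: "0 < \<alpha>" "\<alpha> < 1" and lip: "local_lipschitz (UNIV :: real set) UNIV (\<lambda>_. g)"
    and ab: "a > 0" "b > 0" and diss: "\<And>x. x \<bullet> g x \<le> a - b * (norm x)\<^sup>2"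
  shows "\<exists>x. is_volterra_solution \<alpha> g (id_fun x0) x"
proof -
  \<comment> \<open>Large enough for \<open>x0\<close> to lie inside the ball of radius \<open>sqrt A\<close> and for \<open>a - b * A < 0\<close> on its sphere.\<close>
  define A where "A = (norm x0)\<^sup>2 + a / b + 1"
  define K where "K = cball (0 :: real ^ 'n) (sqrt A)"
  have "0 < a / b" using ab by simp
  then have A: "0 < A" "(norm x0)\<^sup>2 < A" "a < b * A"
    using ab zero_le_power2[of "norm x0"]
    by (auto simp: A_def distrib_left add_pos_nonneg add_nonneg_pos intro: add_pos_pos)
  have K: "compact K" "convex K" "closed K" "K \<noteq> {}"
    using A by (auto simp: K_def)
  have K_iff: "y \<in> K \<longleftrightarrow> (norm y)\<^sup>2 \<le> A" for y
    using real_sqrt_le_iff[of "(norm y)\<^sup>2" A] by (simp add: K_def)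
  obtain L where L: "L-lipschitz_on K g"
    using local_lipschitz_compact_implies_lipschitz[of "{0}" K "\<lambda>_. g"]
      local_lipschitz_subset[OF lip, of "{0}" K] K(1) by auto
  define g' where "g' = (\<lambda>y. g (closest_point K y))"
  have g'_eq: "g' y = g y" if "y \<in> K" for y
    using that by (simp add: g'_def closest_point_self)
  have Lg': "L-lipschitz_on UNIV g'"
  proof (rule lipschitz_onI)
    fix y z
    have "dist (g' y) (g' z) \<le> L * dist (closest_point K y) (closest_point K z)"
      unfolding g'_def using K by (intro lipschitz_onD[OF L] closest_point_in_set)
    also have "\<dots> \<le> L * dist y z"
      using K lipschitz_on_nonneg[OF L] by (intro mult_left_mono closest_point_lipschitz)
    finally show "dist (g' y) (g' z) \<le> L * dist y z" .
  qed (rule lipschitz_on_nonneg[OF L])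
  have "bounded (g ` K)"
    using K(1) lipschitz_on_continuous_on[OF L]
    by (intro compact_imp_bounded compact_continuous_image)
  then obtain M where "\<And>y. y \<in> K \<Longrightarrow> norm (g y) \<le> M"
    unfolding bounded_iff by blast
  then have M: "norm (g' y) \<le> M" for y
    unfolding g'_def using K by (simp add: closest_point_in_set)
  obtain x where x: "continuous_on UNIV x"
    "\<And>t. 0 \<le> t \<Longrightarrow> x t = x0 + (1 / Gamma \<alpha>) *\<^sub>R frac_int \<alpha> (\<lambda>s. g' (x s)) t"
    using lipschitz_volterra_solution_exists[OF \<alpha> Lg' M, of x0] by blast
  have hc: "continuous_on S (\<lambda>s. g' (x s))" for S
    by (rule continuous_on_compose2[OF lipschitz_on_continuous_on[OF Lg'] continuous_on_subset[OF x(1)]]) auto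
  have inK: "x t \<in> K" if "0 \<le> t" for t
  proof -
    have "(norm (x t))\<^sup>2 < A + 0 * max 0 (1 - 1 * t)"
    proof (rule dissipative_barrier[OF \<alpha> _ _ that hc])
      fix s assume "(norm (x s))\<^sup>2 = A + 0 * max 0 (1 - 1 * s)"
      then have "g' (x s) = g (x s)" "(norm (x s))\<^sup>2 = A" by (auto simp: K_iff g'_eq)
      then show "x s \<bullet> g' (x s) < - (\<alpha> * Gamma \<alpha> * (0 * 1 powr \<alpha> / (1 - \<alpha>)))"
        using diss[of "x s"] A by simp
    qed (use x(2) A in auto)
    then show ?thesis by (simp add: K_iff)
  qed
  have "x t = x0 + (1 / Gamma \<alpha>) *\<^sub>R integral {0..t} (\<lambda>s. (t - s) powr (\<alpha> - 1) *\<^sub>R g (x s))"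
    if "0 \<le> t" for t
  proof -
    have "frac_int \<alpha> (\<lambda>s. g' (x s)) t = integral {0..t} (\<lambda>s. (t - s) powr (\<alpha> - 1) *\<^sub>R g (x s))"
      unfolding frac_int_def by (intro integral_cong) (simp add: g'_eq inK)
    then show ?thesis using x(2)[OF that] by simp
  qed
  then show ?thesis
    using continuous_on_subset[OF x(1), of "{0..}"]
    by (auto simp: is_volterra_solution_def C_space_def id_fun_def)
qed

section \<open>Absorption and passage to the limit\<close>

text \<open>
  On the barrier the squared norm is at least \<open>a / b + 1\<close>, where dissipativity gives
  \<open>x \<bullet> g x \<le> - b\<close>. This beats the correction in the barrier lemma as soon as the barrier descends
  slowly enough, and the admissible speed depends only on \<open>R\<close>. So all solutions starting in a ball
  are inside the ball of radius \<open>delta_star a b\<close> from a common time \<open>1 / \<kappa>\<close> on.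
\<close>

lemma volterra_solution_absorbed:
  fixes g :: "real ^ 'n \<Rightarrow> real ^ 'n"
  assumes \<alpha>: "0 < \<alpha>" "\<alpha> < 1" and gc: "continuous_on UNIV g"
    and ab: "a > 0" "b > 0" and diss: "\<And>x. x \<bullet> g x \<le> a - b * (norm x)\<^sup>2"
  obtains \<kappa> where "0 < \<kappa>"
    "\<And>x0 x t. norm x0 \<le> R \<Longrightarrow> is_volterra_solution \<alpha> g (id_fun x0) x \<Longrightarrow> 0 \<le> t \<Longrightarrow>
       (norm (x t))\<^sup>2 < (a / b + 1) + (R\<^sup>2 + 1) * max 0 (1 - \<kappa> * t)"
proof -
  define B where "B = R\<^sup>2 + 1"
  have B: "0 < B" by (simp add: B_def add_nonneg_pos)
  have G: "0 < Gamma \<alpha>" using \<alpha> by (simp add: Gamma_real_pos)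
  have ab': "0 < a / b" using ab by simp
  define c where "c = \<alpha> * Gamma \<alpha> * (B / (1 - \<alpha>))"
  have c: "0 < c" using \<alpha> G B by (simp add: c_def)
  \<comment> \<open>Chosen so that the correction \<open>c * \<kappa> powr \<alpha>\<close> in the barrier lemma equals \<open>b / 2\<close>.\<close>
  define \<kappa> where "\<kappa> = (b / (2 * c)) powr (1 / \<alpha>)"
  have \<kappa>: "0 < \<kappa>" "\<kappa> powr \<alpha> = b / (2 * c)"
    using ab c \<alpha> by (auto simp: \<kappa>_def powr_powr)
  have small: "\<alpha> * Gamma \<alpha> * (B * \<kappa> powr \<alpha> / (1 - \<alpha>)) < b"
  proof -
    have "\<alpha> * Gamma \<alpha> * (B * \<kappa> powr \<alpha> / (1 - \<alpha>)) = c * \<kappa> powr \<alpha>" by (simp add: c_def)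
    also have "\<dots> = b / 2" using c by (simp add: \<kappa>(2))
    also have "\<dots> < b" using ab by simp
    finally show ?thesis .
  qed
  show ?thesis
  proof (rule that[OF \<kappa>(1)])
    fix x0 x and t :: real
    assume x0: "norm x0 \<le> R" and x: "is_volterra_solution \<alpha> g (id_fun x0) x" and t: "0 \<le> t"
    have xc: "continuous_on {0..} x" and
      xeq: "\<And>s. 0 \<le> s \<Longrightarrow> x s = x0 + (1 / Gamma \<alpha>) *\<^sub>R frac_int \<alpha> (\<lambda>r. g (x r)) s"
      using x by (auto simp: is_volterra_solution_def C_space_def id_fun_def frac_int_def)
    have "(norm (x t))\<^sup>2 < (a / b + 1) + B * max 0 (1 - \<kappa> * t)"
    proof (rule dissipative_barrier[OF \<alpha> \<kappa>(1) _ t])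
      show "continuous_on {0..t} (\<lambda>s. g (x s))"
        by (rule continuous_on_compose2[OF gc continuous_on_subset[OF xc]]) auto
      have "(norm x0)\<^sup>2 \<le> R\<^sup>2" using x0 by (intro power_mono) auto
      then show "(norm x0)\<^sup>2 < a / b + 1 + B" using ab' by (simp add: B_def)
      fix s assume "s \<in> {0..t}" and s: "(norm (x s))\<^sup>2 = a / b + 1 + B * max 0 (1 - \<kappa> * s)"
      have "a / b + 1 \<le> (norm (x s))\<^sup>2" unfolding s using B by simp
      then have "b * (a / b + 1) \<le> b * (norm (x s))\<^sup>2" using ab by (intro mult_left_mono) auto
      then have "a - b * (norm (x s))\<^sup>2 \<le> - b" using ab by (simp add: distrib_left)
      then show "x s \<bullet> g (x s) < - (\<alpha> * Gamma \<alpha> * (B * \<kappa> powr \<alpha> / (1 - \<alpha>)))"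
        using diss[of "x s"] small by linarith
    qed (use B xeq in auto)
    then show "(norm (x t))\<^sup>2 < (a / b + 1) + (R\<^sup>2 + 1) * max 0 (1 - \<kappa> * t)"
      by (simp add: B_def)
  qed
qed

text \<open>
  A single summand of the metric controls the supremum over an interval that contains \<open>\<theta>\<close>. The
  boundedness assumption makes \<open>sup_dist\<close> a genuine supremum: of an unbounded set it is an
  unspecified number.
\<close>

lemma C_dist_tendsto_imp_pointwise:
  fixes F :: "nat \<Rightarrow> real \<Rightarrow> real ^ 'n"
  assumes bdd: "\<And>n k. bdd_above ((\<lambda>\<theta>. norm (F n \<theta> - f \<theta>)) ` {0..real k})"
    and lim: "(\<lambda>n. C_dist (F n) f) \<longlonglongrightarrow> 0" and "0 \<le> \<theta>"
  shows "(\<lambda>n. F n \<theta>) \<longlonglongrightarrow> f \<theta>"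
proof -
  define v where "v n = norm (F n \<theta> - f \<theta>)" for n
  obtain k where "\<theta> \<le> real k" using real_arch_simple[of \<theta>] ..
  then have k: "\<theta> \<le> real (Suc k)" by simp
  let ?s = "\<lambda>n j. sup_dist (Suc j) (F n) f"
  let ?term = "\<lambda>n j. 1 / 2 ^ Suc j * (?s n j / (1 + ?s n j))"
  have upper: "norm (F n \<eta> - f \<eta>) \<le> ?s n j" if "0 \<le> \<eta>" "\<eta> \<le> real (Suc j)" for n j \<eta>
    unfolding sup_dist_def using that by (intro cSUP_upper bdd) auto
  have s0: "0 \<le> ?s n j" for n j
    using order_trans[OF norm_ge_zero upper[of 0 j n]] by simp
  have "summable (?term n)" for n
  proof (rule summable_comparison_test')
    show "summable (\<lambda>j. (1 / 2 :: real) ^ Suc j)" by (intro summable_mult2 summable_geometric | simp)+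
    have "?s n j / (1 + ?s n j) \<le> 1" for j using s0[of j n] by (simp add: divide_le_eq)
    then have "?term n j \<le> 1 / 2 ^ Suc j * 1" for j by (intro mult_left_mono) auto
    then show "norm (?term n j) \<le> (1 / 2) ^ Suc j" if "0 \<le> j" for j
      using s0[of j n] by (simp add: power_one_over)
  qed
  then have "sum (?term n) {k} \<le> (\<Sum>j. ?term n j)" for n
    using s0 by (intro sum_le_suminf) auto
  then have "?term n k \<le> C_dist (F n) f" for n
    unfolding C_dist_def by (simp add: add_increasing)
  then have "2 ^ Suc k * ?term n k \<le> 2 ^ Suc k * C_dist (F n) f" for n
    by (intro mult_left_mono) auto
  then have term_le: "?s n k / (1 + ?s n k) \<le> 2 ^ Suc k * C_dist (F n) f" for n
    by simp
  have w_le: "v n / (1 + v n) \<le> 2 ^ Suc k * C_dist (F n) f" for n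
  proof -
    have "0 \<le> v n" "v n \<le> ?s n k"
      using upper[OF \<open>0 \<le> \<theta>\<close> k, of n] by (auto simp: v_def)
    then have "v n / (1 + v n) \<le> ?s n k / (1 + ?s n k)"
      by (simp add: field_simps)
    then show ?thesis using term_le[of n] by linarith
  qed
  have w_ge: "0 \<le> v n / (1 + v n)" for n by (simp add: v_def)
  have "(\<lambda>n. 2 ^ Suc k * C_dist (F n) f) \<longlonglongrightarrow> 0"
    using tendsto_mult_left[OF lim, of "2 ^ Suc k"] by simp
  then have w: "(\<lambda>n. v n / (1 + v n)) \<longlonglongrightarrow> 0"
    by (rule tendsto_sandwich[OF always_eventually always_eventually tendsto_const, rotated -1])
       (use w_le w_ge in blast)+
  \<comment> \<open>\<open>w \<mapsto> w / (1 - w)\<close> inverts \<open>v \<mapsto> v / (1 + v)\<close> and is continuous at \<open>0\<close>.\<close>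
  have "(\<lambda>n. (v n / (1 + v n)) / (1 - v n / (1 + v n))) \<longlonglongrightarrow> 0 / (1 - 0)"
    by (rule tendsto_divide[OF w tendsto_diff[OF tendsto_const w]]) simp
  moreover have "(\<lambda>n. (v n / (1 + v n)) / (1 - v n / (1 + v n))) = v"
  proof
    fix n
    have "0 \<le> v n" by (simp add: v_def)
    then show "(v n / (1 + v n)) / (1 - v n / (1 + v n)) = v n" by (simp add: divide_simps)
  qed
  ultimately have "v \<longlonglongrightarrow> 0" by simp
  then have "(\<lambda>n. F n \<theta> - f \<theta>) \<longlonglongrightarrow> 0"
    unfolding v_def[abs_def] by (rule tendsto_norm_zero_cancel)
  then show ?thesis by (rule LIM_zero_cancel)
qed

lemma powr_shift_difference_tendsto_0:
  fixes \<alpha> c d :: real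
  assumes "0 < \<alpha>" "\<alpha> < 1" "c \<le> d"
  shows "((\<lambda>u. (u + d) powr \<alpha> - (u + c) powr \<alpha>) \<longlongrightarrow> 0) at_top"
proof (rule tendsto_sandwich[OF _ _ tendsto_const])
  have ev: "\<forall>\<^sub>F u in at_top. 0 < u + c"
    using eventually_gt_at_top[of "- c"] by eventually_elim simp
  show "\<forall>\<^sub>F u in at_top. 0 \<le> (u + d) powr \<alpha> - (u + c) powr \<alpha>"
    using ev by eventually_elim (use assms in \<open>auto intro!: powr_mono2\<close>)
  show "\<forall>\<^sub>F u in at_top. (u + d) powr \<alpha> - (u + c) powr \<alpha> \<le> \<alpha> * (d - c) * (u + c) powr (\<alpha> - 1)"
    using ev
  proof eventually_elim
    case (elim u)
    then show ?case using powr_diff_le_tangent[OF assms(1,2) elim, of "u + d"] assms(3) by simp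
  qed
  have "filterlim (\<lambda>u. u + c) at_top at_top"
    using filterlim_tendsto_add_at_top[OF tendsto_const filterlim_ident, of c]
    by (simp add: add.commute)
  then have "((\<lambda>u. \<alpha> * (d - c) * (u + c) powr (\<alpha> - 1)) \<longlongrightarrow> \<alpha> * (d - c) * 0) at_top"
    using assms by (intro tendsto_mult tendsto_const tendsto_neg_powr) auto
  then show "((\<lambda>u. \<alpha> * (d - c) * (u + c) powr (\<alpha> - 1)) \<longlongrightarrow> 0) at_top" by simp
qed

text \<open>
  The integral defining the semiflow is split at \<open>T\<close>. For fixed \<open>T\<close> the contribution of the times
  before \<open>T\<close> vanishes as \<open>t \<rightarrow> \<infinity>\<close>, and that of the times after \<open>T\<close> is a Hoelder bound,
  whose constant is governed by \<open>g\<close> on the late part of the solution only.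
\<close>

lemma volterra_semiflow_difference_le:
  fixes g :: "real ^ 'n \<Rightarrow> real ^ 'n"
  assumes \<alpha>: "0 < \<alpha>" "\<alpha> < 1" and T: "0 \<le> T" "T \<le> t" and \<theta>: "0 \<le> \<theta>1" "\<theta>1 \<le> \<theta>2"
    and hc: "continuous_on {0..t} (\<lambda>s. g (volterra_solution \<alpha> g (id_fun x0) s))"
    and M: "\<And>s. 0 \<le> s \<Longrightarrow> s \<le> T \<Longrightarrow> norm (g (volterra_solution \<alpha> g (id_fun x0) s)) \<le> M"
    and N: "\<And>s. T \<le> s \<Longrightarrow> s \<le> t \<Longrightarrow> norm (g (volterra_solution \<alpha> g (id_fun x0) s)) \<le> N"
  shows "norm (volterra_semiflow \<alpha> g t (id_fun x0) \<theta>1 - volterra_semiflow \<alpha> g t (id_fun x0) \<theta>2)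
    \<le> (M / \<alpha> * ((t + (\<theta>2 - T)) powr \<alpha> - (t + (\<theta>1 - T)) powr \<alpha>) + N / \<alpha> * (\<theta>2 - \<theta>1) powr \<alpha>) / Gamma \<alpha>"
proof -
  have G: "0 < Gamma \<alpha>" using \<alpha> by (simp add: Gamma_real_pos)
  define h where "h s = g (volterra_solution \<alpha> g (id_fun x0) s)" for s
  let ?k = "\<lambda>p s. (p - s) powr (\<alpha> - 1) *\<^sub>R h s"
  have hc: "continuous_on {0..t} h" using hc by (simp add: h_def[abs_def])
  have hc1: "continuous_on {0..T} h" "continuous_on {T..t} h"
    using T by (auto intro: continuous_on_subset[OF hc])
  have split: "integral {0..t} (?k (t + \<theta>)) = integral {0..T} (?k (t + \<theta>)) + integral {T..t} (?k (t + \<theta>))"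
    if "0 \<le> \<theta>" for \<theta>
  proof -
    have "?k (t + \<theta>) integrable_on {0..t}"
      using that T by (intro set_lebesgue_integral_eq_integral(1) kernel_absolutely_integrable \<alpha> hc) auto
    then show ?thesis using T by (simp add: Henstock_Kurzweil_Integration.integral_combine)
  qed
  have N0: "0 \<le> N" using N[of t] T norm_ge_zero order_trans by blast
  let ?D1 = "integral {0..T} (?k (t + \<theta>1)) - integral {0..T} (?k (t + \<theta>2))"
  let ?D2 = "integral {T..t} (?k (t + \<theta>1)) - integral {T..t} (?k (t + \<theta>2))"
  have d1: "norm ?D1 \<le> M / \<alpha> * ((t + \<theta>2 - T) powr \<alpha> - (t + \<theta>1 - T) powr \<alpha>)"
    using M T \<theta> by (intro kernel_difference_integral_norm_le \<alpha> hc1) (auto simp: h_def)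
  have "norm ?D2 \<le> N / \<alpha> * ((t + \<theta>2 - t) powr \<alpha> - (t + \<theta>1 - t) powr \<alpha>)"
    using N T \<theta> by (intro kernel_difference_integral_norm_le \<alpha> hc1) (auto simp: h_def)
  also have "\<dots> \<le> N / \<alpha> * (\<theta>2 - \<theta>1) powr \<alpha>"
    using powr_diff_le_powr[OF \<alpha> \<theta>] N0 \<alpha> by (intro mult_left_mono) auto
  finally have d2: "norm ?D2 \<le> N / \<alpha> * (\<theta>2 - \<theta>1) powr \<alpha>" .
  have "volterra_semiflow \<alpha> g t (id_fun x0) \<theta>1 - volterra_semiflow \<alpha> g t (id_fun x0) \<theta>2
      = (1 / Gamma \<alpha>) *\<^sub>R (?D1 + ?D2)"
    unfolding volterra_semiflow_def id_fun_def[of x0, symmetric] h_def[symmetric]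
    using split[of \<theta>1] split[of \<theta>2] \<theta>
    by (simp add: id_fun_def h_def algebra_simps)
  then have "norm (volterra_semiflow \<alpha> g t (id_fun x0) \<theta>1 - volterra_semiflow \<alpha> g t (id_fun x0) \<theta>2)
      = norm (?D1 + ?D2) / Gamma \<alpha>"
    using G by simp
  also have "\<dots> \<le> (M / \<alpha> * ((t + \<theta>2 - T) powr \<alpha> - (t + \<theta>1 - T) powr \<alpha>) + N / \<alpha> * (\<theta>2 - \<theta>1) powr \<alpha>) / Gamma \<alpha>"
    using norm_triangle_le[OF add_mono[OF d1 d2]] G by (intro divide_right_mono) auto
  finally show ?thesis by (simp add: add_diff_eq)
qed

lemma norm_volterra_semiflow_le:
  fixes g :: "real ^ 'n \<Rightarrow> real ^ 'n"
  assumes \<alpha>: "0 < \<alpha>" "\<alpha> < 1" and t: "0 \<le> t" and \<theta>: "0 \<le> \<theta>" "\<theta> \<le> k"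
    and hc: "continuous_on {0..t} (\<lambda>s. g (volterra_solution \<alpha> g (id_fun x0) s))"
    and M: "\<And>s. 0 \<le> s \<Longrightarrow> s \<le> t \<Longrightarrow> norm (g (volterra_solution \<alpha> g (id_fun x0) s)) \<le> M"
  shows "norm (volterra_semiflow \<alpha> g t (id_fun x0) \<theta>) \<le> norm x0 + M * (t + k) powr \<alpha> / \<alpha> / Gamma \<alpha>"
proof -
  have G: "0 < Gamma \<alpha>" using \<alpha> by (simp add: Gamma_real_pos)
  have M0: "0 \<le> M" using M[of 0] t norm_ge_zero order_trans by blast
  let ?J = "integral {0..t} (\<lambda>s. (t + \<theta> - s) powr (\<alpha> - 1) *\<^sub>R g (volterra_solution \<alpha> g (id_fun x0) s))"
  have "norm ?J \<le> M * ((t + \<theta> - 0) powr \<alpha> - (t + \<theta> - t) powr \<alpha>) / \<alpha>"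
    using M t \<theta> by (intro kernel_integral_norm_le \<alpha> hc) auto
  also have "\<dots> \<le> M * (t + k) powr \<alpha> / \<alpha>"
    using M0 \<alpha> t \<theta> powr_mono2[of \<alpha> "t + \<theta>" "t + k"]
    by (intro divide_right_mono mult_left_mono) (auto simp: diff_le_eq add_increasing2)
  finally have "norm ?J / Gamma \<alpha> \<le> M * (t + k) powr \<alpha> / \<alpha> / Gamma \<alpha>"
    using G by (intro divide_right_mono) auto
  then have "norm ((1 / Gamma \<alpha>) *\<^sub>R ?J) \<le> M * (t + k) powr \<alpha> / \<alpha> / Gamma \<alpha>"
    using G by simp
  then show ?thesis
    unfolding volterra_semiflow_def
    by (intro order_trans[OF norm_triangle_ineq] add_mono) (auto simp: id_fun_def)
qed

lemma norm_le_G_star: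
  fixes g :: "real ^ 'n \<Rightarrow> real ^ 'n"
  assumes gc: "continuous_on UNIV g" and "0 < a" "0 < b" and y: "(norm y)\<^sup>2 \<le> a / b + 1"
  shows "norm (g y) \<le> G_star a b g"
proof -
  have "compact ((\<lambda>y. sqrt (real CARD('n)) * norm (g y)) ` cball 0 (delta_star a b))"
    by (intro compact_continuous_image continuous_intros continuous_on_subset[OF gc]) auto
  then have bdd: "bdd_above ((\<lambda>y. sqrt (real CARD('n)) * norm (g y)) ` cball 0 (delta_star a b))"
    by (intro bounded_imp_bdd_above compact_imp_bounded)
  have "norm y \<le> delta_star a b"
    unfolding delta_star_def by (rule real_le_rsqrt[OF y])
  then have "sqrt (real CARD('n)) * norm (g y) \<le> G_star a b g"
    unfolding G_star_def by (intro cSUP_upper bdd) auto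
  moreover have "1 * norm (g y) \<le> sqrt (real CARD('n)) * norm (g y)"
    by (intro mult_right_mono) (auto simp: Suc_le_eq)
  ultimately show ?thesis by simp
qed

theorem theorem4p9:
  fixes g :: "real ^ 'n \<Rightarrow> real ^ 'n" and \<alpha> a b :: real
  assumes "0 < \<alpha>" and "\<alpha> < 1"
    and "local_lipschitz (UNIV :: real set) UNIV (\<lambda>_. g)"
    and "a > 0" and "b > 0"
    and "\<And>x. x \<bullet> g x \<le> a - b * (norm x)\<^sup>2"
  shows "\<forall>f\<in>volterra_attractor \<alpha> g. \<forall>\<theta>1\<ge>0. \<forall>\<theta>2\<ge>0.
    norm (f \<theta>1 - f \<theta>2) \<le> G_star a b g / (\<alpha> * Gamma \<alpha>) * \<bar>\<theta>1 - \<theta>2\<bar> powr \<alpha>"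
proof (intro ballI allI impI)
  fix f and \<theta>1 \<theta>2 :: real
  assume f: "f \<in> volterra_attractor \<alpha> g" and \<theta>0: "0 \<le> \<theta>1" "0 \<le> \<theta>2"
  note \<alpha> = assms(1,2)
  have gc: "continuous_on UNIV g"
    using local_lipschitz_continuous_on[OF assms(3), of 0] by simp
  obtain x t where fc: "continuous_on {0..} f" and bx: "bounded (range x)"
    and t0: "\<And>n. 0 \<le> t n" and t: "filterlim t at_top sequentially"
    and lim: "(\<lambda>n. C_dist (volterra_semiflow \<alpha> g (t n) (id_fun (x n))) f) \<longlonglongrightarrow> 0"
    using f by (auto simp: volterra_attractor_def C_space_def)
  obtain R where R: "\<And>n. norm (x n) \<le> R" using bx by (auto simp: bounded_iff)
  define X where "X n = volterra_solution \<alpha> g (id_fun (x n))" for n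
  have X: "is_volterra_solution \<alpha> g (id_fun (x n)) (X n)" for n
    unfolding X_def volterra_solution_def
    using dissipative_volterra_solution_exists[OF assms] by (rule someI_ex)
  then have Xc: "continuous_on {0..} (X n)" for n
    by (simp add: is_volterra_solution_def C_space_def)
  have hc: "continuous_on {0..u} (\<lambda>s. g (X n s))" for n u
    by (rule continuous_on_compose2[OF gc continuous_on_subset[OF Xc]]) auto
  obtain \<kappa> where \<kappa>: "0 < \<kappa>" and
    "\<And>x0 x t. norm x0 \<le> R \<Longrightarrow> is_volterra_solution \<alpha> g (id_fun x0) x \<Longrightarrow> 0 \<le> t \<Longrightarrow>
       (norm (x t))\<^sup>2 < (a / b + 1) + (R\<^sup>2 + 1) * max 0 (1 - \<kappa> * t)"
    using volterra_solution_absorbed[OF \<alpha> gc assms(4-6), where R = R] by blast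
  then have absorb: "(norm (X n s))\<^sup>2 < (a / b + 1) + (R\<^sup>2 + 1) * max 0 (1 - \<kappa> * s)" if "0 \<le> s" for n s
    using R X that by blast
  \<comment> \<open>From this time on the barrier has reached the height \<open>a / b + 1\<close>.\<close>
  define T where "T = 1 / \<kappa>"
  have T: "0 < T" using \<kappa> by (simp add: T_def)
  let ?G = "G_star a b g"
  have late: "norm (g (X n s)) \<le> ?G" if "T \<le> s" for n s
  proof -
    have "0 \<le> s" using that T by linarith
    moreover have "max 0 (1 - \<kappa> * s) = 0" using that \<kappa> by (simp add: T_def field_simps)
    ultimately show ?thesis using absorb[of s n] by (intro norm_le_G_star gc assms) simp
  qed
  define \<rho> where "\<rho> = sqrt (a / b + 1 + (R\<^sup>2 + 1))"
  have "compact (g ` cball 0 \<rho>)"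
    by (intro compact_continuous_image continuous_on_subset[OF gc]) auto
  then have "bounded (g ` cball 0 \<rho>)" by (rule compact_imp_bounded)
  then obtain M where M': "\<And>y. y \<in> cball 0 \<rho> \<Longrightarrow> norm (g y) \<le> M"
    unfolding bounded_iff by blast
  have M: "norm (g (X n s)) \<le> M" if "0 \<le> s" for n s
  proof -
    have le: "(R\<^sup>2 + 1) * max 0 (1 - \<kappa> * s) \<le> (R\<^sup>2 + 1) * 1"
      using that \<kappa> by (intro mult_left_mono) auto
    have "(norm (X n s))\<^sup>2 \<le> a / b + 1 + (R\<^sup>2 + 1)"
      using less_imp_le[OF absorb[OF that, of n]] add_left_mono[OF le, unfolded mult_1_right]
      by (rule order_trans)
    then have "norm (X n s) \<le> \<rho>" unfolding \<rho>_def by (rule real_le_rsqrt)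
    then show ?thesis by (intro M') simp
  qed
  let ?F = "\<lambda>n. volterra_semiflow \<alpha> g (t n) (id_fun (x n))"
  have pointwise: "(\<lambda>n. ?F n \<theta>) \<longlonglongrightarrow> f \<theta>" if "0 \<le> \<theta>" for \<theta>
  proof (rule C_dist_tendsto_imp_pointwise[OF _ lim that])
    fix n k
    have "bounded (f ` {0..real k})"
      using continuous_on_subset[OF fc, of "{0..real k}"]
      by (intro compact_imp_bounded compact_continuous_image) auto
    then obtain C where C: "\<And>\<theta>. \<theta> \<in> {0..real k} \<Longrightarrow> norm (f \<theta>) \<le> C"
      unfolding bounded_iff by blast
    have "norm (?F n \<theta> - f \<theta>) \<le> norm (x n) + M * (t n + real k) powr \<alpha> / \<alpha> / Gamma \<alpha> + C"
      if "\<theta> \<in> {0..real k}" for \<theta>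
      using norm_volterra_semiflow_le[OF \<alpha> t0[of n] _ _ hc[of "t n" n, unfolded X_def], of \<theta> "real k" M]
        C[OF that] M[of _ n] that norm_triangle_ineq4[of "?F n \<theta>" "f \<theta>"]
      by (auto simp: X_def)
    then show "bdd_above ((\<lambda>\<theta>. norm (?F n \<theta> - f \<theta>)) ` {0..real k})"
      by (rule bdd_aboveI2)
  qed
  have ordered: "norm (f \<theta>1 - f \<theta>2) \<le> ?G / (\<alpha> * Gamma \<alpha>) * (\<theta>2 - \<theta>1) powr \<alpha>"
    if \<theta>: "0 \<le> \<theta>1" "\<theta>1 \<le> \<theta>2" for \<theta>1 \<theta>2
  proof (rule tendsto_le[OF sequentially_bot])
    let ?d = "\<lambda>u. (u + (\<theta>2 - T)) powr \<alpha> - (u + (\<theta>1 - T)) powr \<alpha>"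
    show "(\<lambda>n. norm (?F n \<theta>1 - ?F n \<theta>2)) \<longlonglongrightarrow> norm (f \<theta>1 - f \<theta>2)"
      using \<theta> by (intro tendsto_norm tendsto_diff pointwise) auto
    have "(\<lambda>n. ?d (t n)) \<longlonglongrightarrow> 0"
      using \<theta> by (intro filterlim_compose[OF powr_shift_difference_tendsto_0 t] \<alpha>) simp
    then have "(\<lambda>n. (M / \<alpha> * ?d (t n) + ?G / \<alpha> * (\<theta>2 - \<theta>1) powr \<alpha>) / Gamma \<alpha>)
        \<longlonglongrightarrow> (M / \<alpha> * 0 + ?G / \<alpha> * (\<theta>2 - \<theta>1) powr \<alpha>) / Gamma \<alpha>"
      using \<alpha> by (intro tendsto_intros) (auto simp: Gamma_real_pos less_imp_neq[symmetric])
    then show "(\<lambda>n. (M / \<alpha> * ?d (t n) + ?G / \<alpha> * (\<theta>2 - \<theta>1) powr \<alpha>) / Gamma \<alpha>)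
        \<longlonglongrightarrow> ?G / (\<alpha> * Gamma \<alpha>) * (\<theta>2 - \<theta>1) powr \<alpha>"
      by (simp add: field_simps)
    have "\<forall>\<^sub>F n in sequentially. T \<le> t n"
      using t by (simp add: filterlim_at_top)
    then show "\<forall>\<^sub>F n in sequentially. norm (?F n \<theta>1 - ?F n \<theta>2)
        \<le> (M / \<alpha> * ?d (t n) + ?G / \<alpha> * (\<theta>2 - \<theta>1) powr \<alpha>) / Gamma \<alpha>"
    proof eventually_elim
      case (elim n)
      show ?case
        using M[of _ n] late[of _ n]
        by (intro volterra_semiflow_difference_le \<alpha> \<theta> elim less_imp_le[OF T] hc[of "t n" n, unfolded X_def])
           (auto simp: X_def)
    qed
  qed
  show "norm (f \<theta>1 - f \<theta>2) \<le> ?G / (\<alpha> * Gamma \<alpha>) * \<bar>\<theta>1 - \<theta>2\<bar> powr \<alpha>"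
    using ordered[of \<theta>1 \<theta>2] ordered[of \<theta>2 \<theta>1] \<theta>0
    by (cases "\<theta>1 \<le> \<theta>2") (auto simp: norm_minus_commute abs_real_def)
qed
end
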